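(* Let $n\ge 2$, $\nu\in(0,1]$, $\beta_1,\dots,\beta_n>0$ and $\bar\beta=\sum_{i=1}^n\beta_i$. Let $\bm{Q}=(Q_1,\dots,Q_{n-1})$ be a random vector having the fractional Dirichlet probability density function \begin{align*} f_{\bm{Q}}(q_1,\dots,q_{n-1}) = {}& \left( \prod_{i=1}^{n-1} q_i^{\nu \beta_i-1} \right)\left( 1-\sum_{i=1}^{n-1} q_i\right)^{\nu \beta_n-1} \\ &\times \int_0^\infty y^{\nu \bar{\beta} -1} \left(\prod_{i=1}^{n-1} E_{\nu,\nu \beta_i}^{\beta_i}\bigl(-(yq_i)^\nu\bigr)\right) E_{\nu,\nu \beta_n}^{\beta_n} \biggl( -\Bigl( y-y\sum_{i=1}^{n-1}q_i \Bigr)^\nu \biggr)\, \mathrm dy \end{align*} on $\{q_i>0,\ \sum_{i=1}^{n-1}q_i<1\}$. Then, for each $j=1,\dots,n-1$, $$\mathbb{E}\,Q_j=\frac{\beta_j}{\bar\beta},\qquad \mathrm{Var}\,Q_j=\frac{\beta_j(\bar\beta-\beta_j)}{\bar\beta^2(\bar\beta+1)}\bigl(1+\bar\beta(1-\nu)\bigr).$$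
   Context: The three-parameter Mittag-Leffler function is $E_{\alpha,\beta}^\delta(z) = \sum_{r=0}^\infty \frac{z^r}{\Gamma(\alpha r + \beta)}\frac{\Gamma(\delta+r)}{r!\,\Gamma(\delta)}$. For $\lambda>0$, $\beta>0$, $\nu\in(0,1]$, a positive random variable $X$ is fractional Gamma distributed, written $X\sim FG(\lambda,\beta,\nu)$, if it has probability density function $\lambda^\beta x^{\nu\beta-1}E_{\nu,\nu\beta}^{\beta}(-\lambda x^\nu)$, $x>0$; its Laplace transform is $\mathbb{E}e^{-zX}=\left(\frac{\lambda}{\lambda+z^\nu}\right)^\beta$, $z>0$. The density $f_{\bm Q}$ in the claim is that of $(Z_1/W,\dots,Z_{n-1}/W)$, where $Z_1,\dots,Z_n$ are independent, $Z_i\sim FG(1,\beta_i,\nu)$, and $W=Z_1+\dots+Z_n$. *)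

theory Defs
  imports "HOL-Probability.Probability"
begin

definition mittag_leffler :: "real \<Rightarrow> real \<Rightarrow> real \<Rightarrow> real \<Rightarrow> real" where
  "mittag_leffler \<alpha> \<beta> \<delta> z =
     (\<Sum>r. z ^ r / Gamma (\<alpha> * real r + \<beta>) * (Gamma (\<delta> + real r) / (fact r * Gamma \<delta>)))"

text \<open>
  A point of the (n - 1)-dimensional domain is a function \<open>q\<close> on the index set \<open>{1..<n}\<close>;
  the parameters \<open>\<beta>\<close> are indexed by \<open>{1..n}\<close>.
\<close>

definition fractional_dirichlet_density ::
    "real \<Rightarrow> nat \<Rightarrow> (nat \<Rightarrow> real) \<Rightarrow> (nat \<Rightarrow> real) \<Rightarrow> real" where
  "fractional_dirichlet_density \<nu> n \<beta> q =
     (if (\<forall>i\<in>{1..<n}. 0 < q i) \<and> (\<Sum>i=1..<n. q i) < 1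
      then (\<Prod>i=1..<n. q i powr (\<nu> * \<beta> i - 1)) * (1 - (\<Sum>i=1..<n. q i)) powr (\<nu> * \<beta> n - 1) *
           (LBINT y:{0<..}. y powr (\<nu> * (\<Sum>i=1..n. \<beta> i) - 1) *
              (\<Prod>i=1..<n. mittag_leffler \<nu> (\<nu> * \<beta> i) (\<beta> i) (- ((y * q i) powr \<nu>))) *
              mittag_leffler \<nu> (\<nu> * \<beta> n) (\<beta> n) (- ((y - y * (\<Sum>i=1..<n. q i)) powr \<nu>)))
      else 0)"

end

theory Submission
  imports Defs "HOL-Complex_Analysis.Cauchy_Integral_Formula" "HOL-Real_Asymp.Real_Asymp"
begin

text \<open>
  Integrating the Mittag-Leffler series termwise shows that the fractional Gamma density \<open>g\<close> has
  Laplace transform \<open>F s = (1 + s powr \<nu>) powr - \<beta>\<close> for \<open>s > 1\<close>. The Taylor coefficients of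
  \<open>t \<mapsto> F (c - t)\<close> are nonnegative, so \<open>F\<close> is completely monotone, whence \<open>g \<ge> 0\<close> by
  Post-Widder inversion; positivity in turn extends the Laplace transform to all \<open>s > 0\<close> by monotone
  convergence of the Taylor series.

  The substitution \<open>z = y q\<close>, \<open>x = y - \<Sum>i. z i\<close> turns the \<open>k\<close>-th moment of \<open>Q j\<close> into the
  expectation of \<open>(z j / W) ^ k\<close> with \<open>W = x + (\<Sum>i. z i)\<close> for independent fractional Gamma
  variables. Writing \<open>1 / W ^ k\<close> as the integral of \<open>s ^ (k - 1) exp (- s W) / fact (k - 1)\<close> over
  \<open>s > 0\<close> factorises this expectation into Laplace transforms and their derivatives, and the
  remaining integral over \<open>s\<close> is elementary.
\<close>

subsection \<open>Power series with nonnegative coefficients\<close>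

text \<open>Everything hinges on the sign of the fractional Gamma density. It is given by an
  alternating series whose sign cannot be read off its terms, and integrating the absolute terms
  gives a multiple of (1 - s^-\<nu>)^-\<beta>, which is finite only for s > 1. Yet nonnegativity
  licenses Tonelli in all later integrals, and the integral over the Laplace variable runs down to s
  = 0, so both gaps must be closed. Power series with nonnegative coefficients close them. Around c
  > 1 the closed form expands for all t < c, that is down to s = 0, while the Laplace integral is
  known only for t < c - 1. Uniqueness of coefficients on the overlap takes the place of analytic
  continuation. The series are considered on 0 \<le> t < R only, where all terms are nonnegative and
  rearrangements are free.\<close>

definition nonneg_power_series :: "real \<Rightarrow> (real \<Rightarrow> real) \<Rightarrow> bool" where
  "nonneg_power_series R f \<longleftrightarrow>
     (\<exists>a. (\<forall>k. 0 \<le> a k) \<and> (\<forall>t. 0 \<le> t \<longrightarrow> t < R \<longrightarrow> (\<lambda>k. a k * t ^ k) sums f t))"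

lemma nonneg_power_seriesI:
  assumes "\<And>k. 0 \<le> a k" "\<And>t. 0 \<le> t \<Longrightarrow> t < R \<Longrightarrow> (\<lambda>k. a k * t ^ k) sums f t"
  shows "nonneg_power_series R f"
  using assms unfolding nonneg_power_series_def by blast

lemma nonneg_power_series_nonneg:
  assumes "nonneg_power_series R f" "0 \<le> t" "t < R"
  shows "0 \<le> f t"
proof -
  obtain a where "\<And>k. 0 \<le> a k" "(\<lambda>k. a k * t ^ k) sums f t"
    using assms unfolding nonneg_power_series_def by blast
  then show ?thesis
    using sums_le[OF _ sums_zero, of "\<lambda>k. a k * t ^ k" "f t"] assms by auto
qed

lemma nonneg_power_series_const:
  assumes "0 \<le> c"
  shows "nonneg_power_series R (\<lambda>_. c)"
proof (rule nonneg_power_seriesI)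
  fix t :: real
  show "(\<lambda>k. (if k = 0 then c else 0) * t ^ k) sums c"
    by (rule sums_cong[THEN iffD1, OF _ sums_single[of 0 "\<lambda>_. c"]]) auto
qed (use assms in auto)

text \<open>Cauchy product: absolute convergence is automatic since all terms are nonnegative, and
  convolution preserves the sign of the coefficients.\<close>

lemma nonneg_power_series_mult:
  assumes "nonneg_power_series R f" "nonneg_power_series R g"
  shows "nonneg_power_series R (\<lambda>t. f t * g t)"
proof -
  obtain a where a: "\<And>k. 0 \<le> a k" "\<And>t. 0 \<le> t \<Longrightarrow> t < R \<Longrightarrow> (\<lambda>k. a k * t ^ k) sums f t"
    using assms(1) unfolding nonneg_power_series_def by blast
  obtain b where b: "\<And>k. 0 \<le> b k" "\<And>t. 0 \<le> t \<Longrightarrow> t < R \<Longrightarrow> (\<lambda>k. b k * t ^ k) sums g t"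
    using assms(2) unfolding nonneg_power_series_def by blast
  show ?thesis
  proof (rule nonneg_power_seriesI)
    fix t :: real assume t: "0 \<le> t" "t < R"
    have "(\<lambda>k. \<Sum>i\<le>k. (a i * t ^ i) * (b (k - i) * t ^ (k - i))) sums
            ((\<Sum>k. a k * t ^ k) * (\<Sum>k. b k * t ^ k))"
      using a b t by (intro Cauchy_product_sums) (auto simp: sums_iff)
    moreover have "(\<Sum>i\<le>k. (a i * t ^ i) * (b (k - i) * t ^ (k - i))) = (\<Sum>i\<le>k. a i * b (k - i)) * t ^ k" for k
      unfolding sum_distrib_right
    proof (rule sum.cong)
      fix i assume "i \<in> {..k}"
      then have "t ^ k = t ^ i * t ^ (k - i)" by (simp flip: power_add)
      then show "(a i * t ^ i) * (b (k - i) * t ^ (k - i)) = a i * b (k - i) * t ^ k" by simp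
    qed simp
    ultimately show "(\<lambda>k. (\<Sum>i\<le>k. a i * b (k - i)) * t ^ k) sums (f t * g t)"
      using a(2)[OF t] b(2)[OF t] by (simp add: sums_iff)
  qed (use a b in \<open>auto intro!: sum_nonneg\<close>)
qed

lemma nonneg_power_series_power:
  assumes "nonneg_power_series R f"
  shows "nonneg_power_series R (\<lambda>t. f t ^ m)"
  by (induction m) (auto intro: nonneg_power_series_const nonneg_power_series_mult assms)

text \<open>Sums over \<open>nat\<close> are integrals over the counting measure, so monotone
  convergence for \<open>nn_integral\<close> already is the exchange of two sums.\<close>

lemma suminf_ennreal_swap:
  fixes f :: "nat \<Rightarrow> nat \<Rightarrow> ennreal"
  shows "(\<Sum>i. \<Sum>j. f i j) = (\<Sum>j. \<Sum>i. f i j)"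
  using nn_integral_suminf[of "\<lambda>j i. f i j" "count_space UNIV"]
  by (simp add: nn_integral_count_space_nat)

text \<open>Tonelli for the double series of the nonnegative entries \<open>a m k * t ^ k\<close>.
  Together with closure under powers this makes substitution of one nonnegative series into another
  possible.\<close>

lemma nonneg_power_series_sums:
  assumes "0 < R" and f: "\<And>m. nonneg_power_series R (f m)"
    and g: "\<And>t. 0 \<le> t \<Longrightarrow> t < R \<Longrightarrow> (\<lambda>m. f m t) sums g t"
  shows "nonneg_power_series R g"
proof -
  have "\<exists>a. (\<forall>k. 0 \<le> a k) \<and> (\<forall>t. 0 \<le> t \<longrightarrow> t < R \<longrightarrow> (\<lambda>k. a k * t ^ k) sums f m t)" for m
    using f unfolding nonneg_power_series_def by blast
  then obtain a where a: "\<And>m k. 0 \<le> a m k"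
    and sums: "\<And>m t. 0 \<le> t \<Longrightarrow> t < R \<Longrightarrow> (\<lambda>k. a m k * t ^ k) sums f m t" by metis
  have le: "a m k * t ^ k \<le> f m t" if "0 \<le> t" "t < R" for m k t
    using sum_le_suminf[of "\<lambda>k. a m k * t ^ k" "{k}"] sums[OF that, of m] a that by (auto simp: sums_iff)
  have summ: "summable (\<lambda>m. a m k)" for k
  proof -
    \<comment> \<open>R/2 stands for any interior positive point: each single term there is at most
      \<open>f m (R/2)\<close>, which is summable over \<open>m\<close>.\<close>
    have "summable (\<lambda>m. a m k * (R/2) ^ k)"
    proof (rule summable_comparison_test)
      show "summable (\<lambda>m. f m (R/2))" using g[of "R/2"] \<open>0 < R\<close> by (auto simp: sums_iff)
    qed (use le a \<open>0 < R\<close> in auto)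
    then show ?thesis using \<open>0 < R\<close> by (simp add: summable_cmult_iff mult.commute[of _ "_ ^ _"])
  qed
  show ?thesis
  proof (rule nonneg_power_seriesI)
    show "0 \<le> (\<Sum>m. a m k)" for k using summ a by (intro suminf_nonneg)
    fix t :: real assume t: "0 \<le> t" "t < R"
    have fpos: "0 \<le> f m t" for m using nonneg_power_series_nonneg[OF f t] .
    have gpos: "0 \<le> g t" using g[OF t] suminf_nonneg[of "\<lambda>m. f m t"] fpos by (simp add: sums_iff)
    have "(\<Sum>k. ennreal ((\<Sum>m. a m k) * t ^ k)) = (\<Sum>k. \<Sum>m. ennreal (a m k * t ^ k))"
    proof (rule suminf_cong)
      fix k
      have "(\<lambda>m. a m k * t ^ k) sums ((\<Sum>m. a m k) * t ^ k)"
        using summ[of k] by (intro sums_mult2 summable_sums)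
      then show "ennreal ((\<Sum>m. a m k) * t ^ k) = (\<Sum>m. ennreal (a m k * t ^ k))"
        using a t by (intro suminf_ennreal_eq[symmetric]) auto
    qed
    also have "\<dots> = (\<Sum>m. \<Sum>k. ennreal (a m k * t ^ k))" by (rule suminf_ennreal_swap)
    also have "\<dots> = (\<Sum>m. ennreal (f m t))"
      using sums[OF t] a t by (intro suminf_cong suminf_ennreal_eq) auto
    also have "\<dots> = ennreal (g t)" using g[OF t] fpos by (intro suminf_ennreal_eq)
    finally have "(\<lambda>k. ennreal ((\<Sum>m. a m k) * t ^ k)) sums ennreal (g t)"
      using summable_sums[OF summableI, of "\<lambda>k. ennreal ((\<Sum>m. a m k) * t ^ k)"] by simp
    then show "(\<lambda>k. (\<Sum>m. a m k) * t ^ k) sums g t"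
      using t a summ gpos by (subst (asm) sums_ennreal) (auto intro!: suminf_nonneg mult_nonneg_nonneg)
  qed
qed

text \<open>The binomial coefficient of -\<beta> over m carries the sign (-1)^m, and so does (-u)^m;
  the two cancel. Since \<open>\<beta>\<close> may be negative, \<beta> = -\<nu> also yields the
  series of (1 - u)^\<nu>.\<close>

lemma pochhammer_div_fact_sums:
  fixes \<beta> u :: real
  assumes "\<bar>u\<bar> < 1"
  shows "(\<lambda>m. pochhammer \<beta> m / fact m * u ^ m) sums (1 - u) powr (-\<beta>)"
proof -
  have "(\<lambda>m. (-\<beta> gchoose m) * (-u) ^ m) sums (1 + - u) powr (-\<beta>)"
    using assms by (intro gen_binomial_real) auto
  moreover have "(-\<beta> gchoose m) * (-u) ^ m = pochhammer \<beta> m / fact m * u ^ m" for m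
  proof -
    have "(-1) ^ m * (-1) ^ m = (1::real)" by (simp flip: power_mult_distrib)
    then show ?thesis by (simp add: gbinomial_pochhammer power_minus[of u m])
  qed
  ultimately show ?thesis by simp
qed

lemma pochhammer_ge_zero: "0 \<le> x \<Longrightarrow> 0 \<le> pochhammer (x::real) n"
  by (simp add: pochhammer_prod prod_nonneg)

text \<open>By \<open>pochhammer (-\<nu>) (Suc k) = -\<nu> * pochhammer (1 - \<nu>) k\<close> all
  coefficients of (1 - s)^\<nu> after the constant one are nonpositive. This is where
  \<open>\<nu> \<le> 1\<close> enters: the second coefficient \<nu>(1 - \<nu>)/2 would otherwise be
  negative.\<close>

lemma nonneg_power_series_one_minus_powr:
  assumes "0 < \<nu>" "\<nu> \<le> (1::real)"
  shows "nonneg_power_series 1 (\<lambda>s. 1 - (1 - s) powr \<nu>)"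
proof (rule nonneg_power_seriesI)
  fix k
  show "0 \<le> (if k = 0 then 0 else - pochhammer (-\<nu>) k / fact k)"
    using assms by (cases k) (auto simp: pochhammer_rec intro!: mult_nonneg_nonneg divide_nonneg_nonneg pochhammer_ge_zero)
next
  fix s :: real assume s: "0 \<le> s" "s < 1"
  have "(\<lambda>k. (if k = 0 then 1 else 0) - pochhammer (-\<nu>) k / fact k * s ^ k) sums (1 - (1 - s) powr \<nu>)"
    using pochhammer_div_fact_sums[of s "-\<nu>"] s sums_single[of 0 "\<lambda>_. 1::real"]
    by (intro sums_diff) auto
  moreover have "(if k = 0 then 1 else 0) - pochhammer (-\<nu>) k / fact k * s ^ k =
      (if k = 0 then 0 else - pochhammer (-\<nu>) k / fact k) * s ^ k" for k by simp
  ultimately show "(\<lambda>k. (if k = 0 then 0 else - pochhammer (-\<nu>) k / fact k) * s ^ k) sums (1 - (1 - s) powr \<nu>)"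
    by simp
qed

lemma nonneg_power_series_scale:
  assumes "nonneg_power_series R f" "0 < c"
  shows "nonneg_power_series (c * R) (\<lambda>t. f (t / c))"
proof -
  obtain a where a: "\<And>k. 0 \<le> a k" "\<And>t. 0 \<le> t \<Longrightarrow> t < R \<Longrightarrow> (\<lambda>k. a k * t ^ k) sums f t"
    using assms(1) unfolding nonneg_power_series_def by blast
  show ?thesis
  proof (rule nonneg_power_seriesI)
    show "0 \<le> a k / c ^ k" for k using a assms by simp
    fix t assume "0 \<le> t" "t < c * R"
    then show "(\<lambda>k. a k / c ^ k * t ^ k) sums f (t / c)"
      using a(2)[of "t / c"] assms(2) by (simp add: field_simps power_divide)
  qed
qed

text \<open>
  With \<open>h s = 1 - (1 - s) powr \<nu>\<close> and \<open>p = c powr \<nu> / (1 + c powr \<nu>)\<close> one has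
  \<open>1 + (c - c s) powr \<nu> = (1 + c powr \<nu>) (1 - p h s)\<close>, and both \<open>h\<close> and the binomial series of
  \<open>(1 - u) powr - \<beta>\<close> have nonnegative coefficients.
\<close>

lemma nonneg_power_series_fractional_gamma_laplace:
  fixes c \<nu> \<beta> :: real
  assumes "0 < \<nu>" "\<nu> \<le> 1" "0 < \<beta>" "0 < c"
  shows "nonneg_power_series c (\<lambda>t. (1 + (c - t) powr \<nu>) powr (-\<beta>))"
proof -
  define h where "h s = 1 - (1 - s) powr \<nu>" for s :: real
  define p where "p = c powr \<nu> / (1 + c powr \<nu>)"
  have p: "0 < p" "p < 1" using assms by (auto simp: p_def field_simps add_pos_pos)
  have h: "nonneg_power_series 1 h"
    unfolding h_def using assms by (intro nonneg_power_series_one_minus_powr)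
  have "nonneg_power_series 1 (\<lambda>s. (1 - p * h s) powr (-\<beta>))"
  proof (rule nonneg_power_series_sums)
    show "nonneg_power_series 1 (\<lambda>s. pochhammer \<beta> m / fact m * (p * h s) ^ m)" for m
      using h p assms
      by (intro nonneg_power_series_mult nonneg_power_series_power nonneg_power_series_const)
        (auto intro!: divide_nonneg_pos pochhammer_ge_zero)
    fix t :: real assume t: "0 \<le> t" "t < 1"
    have "0 \<le> h t" by (rule nonneg_power_series_nonneg[OF h t])
    moreover have "h t \<le> 1" by (simp add: h_def)
    \<comment> \<open>Strictness comes from \<open>p < 1\<close>: \<open>h t\<close> is only known
      to be at most 1, so the factor \<open>p\<close> keeps the argument inside the disc of
      convergence.\<close>
    ultimately have "0 \<le> p * h t" "p * h t \<le> p * 1" using p by (auto intro!: mult_left_mono)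
    then have "\<bar>p * h t\<bar> < 1" using p by linarith
    then show "(\<lambda>m. pochhammer \<beta> m / fact m * (p * h t) ^ m) sums (1 - p * h t) powr (-\<beta>)"
      by (rule pochhammer_div_fact_sums)
  qed simp
  then have "nonneg_power_series 1 (\<lambda>s. (1 + c powr \<nu>) powr (-\<beta>) * (1 - p * h s) powr (-\<beta>))"
    by (intro nonneg_power_series_mult nonneg_power_series_const) auto
  from nonneg_power_series_scale[OF this \<open>0 < c\<close>]
  have *: "nonneg_power_series c (\<lambda>t. (1 + c powr \<nu>) powr (-\<beta>) * (1 - p * h (t / c)) powr (-\<beta>))"
    by simp
  have eq: "(1 + c powr \<nu>) powr (-\<beta>) * (1 - p * h (t / c)) powr (-\<beta>) = (1 + (c - t) powr \<nu>) powr (-\<beta>)"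
    if t: "0 \<le> t" "t < c" for t
  proof -
    have pos1: "0 < 1 + c powr \<nu>" by (intro add_pos_nonneg) auto
    have "c - t = c * (1 - t / c)" using assms by (simp add: field_simps)
    then have "(c - t) powr \<nu> = c powr \<nu> * (1 - h (t / c))"
      using assms t by (simp add: h_def powr_mult)
    moreover have "(1 + c powr \<nu>) * p = c powr \<nu>"
      using pos1 by (simp add: p_def)
    ultimately have *: "(1 + c powr \<nu>) * (1 - p * h (t / c)) = 1 + (c - t) powr \<nu>"
      by (simp add: right_diff_distrib flip: mult.assoc)
    have "0 < (1 + c powr \<nu>) * (1 - p * h (t / c))" unfolding * by (simp add: add_pos_nonneg)
    then have "0 < 1 - p * h (t / c)" using pos1 by (metis zero_less_mult_pos)
    then show ?thesis unfolding *[symmetric] by (intro powr_mult[symmetric])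
  qed
  show ?thesis
    using * unfolding nonneg_power_series_def by (auto simp: eq)
qed

text \<open>A nonzero power series that vanishes at the origin has an isolated zero there, so
  agreement to the right of 0 suffices: the difference vanishes on [0, R), which meets every
  punctured neighbourhood of 0.\<close>

lemma power_series_coeffs_unique:
  fixes a b :: "nat \<Rightarrow> real"
  assumes "0 < R" and a: "\<And>t. 0 \<le> t \<Longrightarrow> t < R \<Longrightarrow> (\<lambda>k. a k * t ^ k) sums f t"
    and b: "\<And>t. 0 \<le> t \<Longrightarrow> t < R \<Longrightarrow> (\<lambda>k. b k * t ^ k) sums f t"
  shows "a = b"
proof (rule ccontr)
  assume "a \<noteq> b"
  then obtain m where m: "a m \<noteq> b m" by blast
  define d where "d k = a k - b k" for k
  have zero: "(\<lambda>k. d k * t ^ k) sums 0" if "0 \<le> t" "t < R" for t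
    using sums_diff[OF a[OF that] b[OF that]] by (simp add: d_def left_diff_distrib)
  \<comment> \<open>Evaluation at 0 settles the constant coefficient, so the index where the series
    differ is positive, as the isolated-zero theorem demands.\<close>
  have "d 0 = 0" using zero[of 0] \<open>0 < R\<close> by (simp add: powser_sums_zero_iff)
  then have "0 < m" using m by (cases m) (auto simp: d_def)
  have sm: "(\<lambda>k. d k * (t - 0) ^ k) sums (\<Sum>k. d k * t ^ k)" if t: "norm (t - 0) < R / 2" for t
  proof -
    have "summable (\<lambda>k. d k * (R / 2) ^ k)" using zero[of "R/2"] \<open>0 < R\<close> by (auto simp: sums_iff)
    from powser_inside[OF this, of t] t show ?thesis by (auto simp: sums_iff)
  qed
  have "0 < R / 2" "(\<Sum>k. d k * 0 ^ k) = 0" "d m \<noteq> 0"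
    using \<open>0 < R\<close> \<open>d 0 = 0\<close> m by (auto simp: d_def)
  from powser_0_nonzero[OF this(1) sm this(2,3) \<open>0 < m\<close>]
  obtain s where s: "0 < s" "\<And>z. z \<in> cball 0 s - {0} \<Longrightarrow> (\<Sum>k. d k * z ^ k) \<noteq> 0"
    by metis
  have "(\<Sum>k. d k * min s (R / 2) ^ k) = 0"
    using zero[of "min s (R / 2)"] s(1) \<open>0 < R\<close> by (simp add: sums_iff min_def)
  moreover have "min s (R / 2) \<in> cball 0 s - {0}" using s(1) \<open>0 < R\<close> by auto
  ultimately show False using s(2) by blast
qed

subsection \<open>The fractional Gamma density and its Laplace transform\<close>

lemma nn_integral_powr_exp:
  assumes "0 < a" "0 < (s::real)"
  shows "(\<integral>\<^sup>+x. ennreal (indicator {0<..} x * x powr (a - 1) * exp (- (s * x))) \<partial>lborel) = ennreal (Gamma a / s powr a)"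
proof -
  have "ennreal (Gamma a) = (\<integral>\<^sup>+t. ennreal (indicator {0..} t * t powr (a - 1) / exp t) \<partial>lborel)"
    using Gamma_conv_nn_integral_real[OF assms(1)] .
  also have "\<dots> = s * (\<integral>\<^sup>+x. ennreal (indicator {0..} (s * x) * (s * x) powr (a - 1) / exp (s * x)) \<partial>lborel)"
    using assms by (subst nn_integral_real_affine[where c = s and t = 0]) auto
  also have "(\<integral>\<^sup>+x. ennreal (indicator {0..} (s * x) * (s * x) powr (a - 1) / exp (s * x)) \<partial>lborel) =
      (\<integral>\<^sup>+x. ennreal (s powr (a - 1)) * ennreal (indicator {0<..} x * x powr (a - 1) * exp (- (s * x))) \<partial>lborel)"
    using assms
    by (intro nn_integral_cong, subst ennreal_mult[symmetric])
      (auto simp: indicator_def zero_le_mult_iff powr_mult exp_minus divide_inverse less_le)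
  also have "\<dots> = s powr (a - 1) * (\<integral>\<^sup>+x. ennreal (indicator {0<..} x * x powr (a - 1) * exp (- (s * x))) \<partial>lborel)"
    by (intro nn_integral_cmult) auto
  finally have *: "ennreal (Gamma a) = ennreal (s powr a) *
      (\<integral>\<^sup>+x. ennreal (indicator {0<..} x * x powr (a - 1) * exp (- (s * x))) \<partial>lborel)"
    using assms by (simp add: mult.assoc[symmetric] ennreal_mult[symmetric] powr_mult_base)
  have "ennreal (Gamma a / s powr a) = ennreal (1 / s powr a) * ennreal (Gamma a)"
    using assms by (simp add: ennreal_mult[symmetric])
  also have "\<dots> = (\<integral>\<^sup>+x. ennreal (indicator {0<..} x * x powr (a - 1) * exp (- (s * x))) \<partial>lborel)"
    unfolding * using assms by (simp add: mult.assoc[symmetric] ennreal_mult[symmetric])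
  finally show ?thesis ..
qed

text \<open>The density of FG(1, \<beta>, \<nu>), extended by 0 so that all integrals can run over
  the whole of \<open>lborel\<close>.\<close>

definition fg_density :: "real \<Rightarrow> real \<Rightarrow> real \<Rightarrow> real" where
  "fg_density \<nu> \<beta> x =
     (if 0 < x then x powr (\<nu> * \<beta> - 1) * mittag_leffler \<nu> (\<nu> * \<beta>) \<beta> (- (x powr \<nu>)) else 0)"

lemma borel_measurable_mittag_leffler [measurable]:
  "mittag_leffler \<alpha> \<beta> \<delta> \<in> borel_measurable borel"
  unfolding mittag_leffler_def by measurable

lemma borel_measurable_fg_density [measurable]: "fg_density \<nu> \<beta> \<in> borel_measurable borel"
  unfolding fg_density_def by measurable

text \<open>The Mittag-Leffler coefficient with the quotient of Gamma values written as a Pochhammer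
  symbol, which exhibits the binomial coefficient that survives the Laplace transform.\<close>

definition ml_coeff :: "real \<Rightarrow> real \<Rightarrow> nat \<Rightarrow> real" where
  "ml_coeff \<nu> \<beta> r = pochhammer \<beta> r / fact r / Gamma (\<nu> * (\<beta> + real r))"

text \<open>The unsigned term of the density series. The sign (-1)^r is kept apart so that Tonelli
  applies to these terms.\<close>

definition fg_term :: "real \<Rightarrow> real \<Rightarrow> nat \<Rightarrow> real \<Rightarrow> real" where
  "fg_term \<nu> \<beta> r x = indicator {0<..} x * ml_coeff \<nu> \<beta> r * x powr (\<nu> * (\<beta> + real r) - 1)"

lemma borel_measurable_fg_term [measurable]: "fg_term \<nu> \<beta> r \<in> borel_measurable borel"
  unfolding fg_term_def by measurable

lemma summable_ennrealI:
  assumes "\<And>i. 0 \<le> f i" "(\<Sum>i. ennreal (f i)) < \<infinity>"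
  shows "summable f"
  using assms by (intro summable_suminf_not_top) auto

locale fractional_gamma =
  fixes \<nu> \<beta> :: real
  assumes nu_pos: "0 < \<nu>" and nu_le: "\<nu> \<le> 1" and beta_pos: "0 < \<beta>"
begin

lemma ml_coeff_nonneg: "0 \<le> ml_coeff \<nu> \<beta> r"
  using nu_pos beta_pos unfolding ml_coeff_def
  by (intro divide_nonneg_nonneg pochhammer_ge_zero Gamma_real_nonneg) (auto intro: mult_nonneg_nonneg)

lemma fg_term_nonneg: "0 \<le> fg_term \<nu> \<beta> r x"
  using ml_coeff_nonneg by (simp add: fg_term_def)

lemma fg_term_eq:
  assumes "0 < x"
  shows "fg_term \<nu> \<beta> r x = x powr (\<nu> * \<beta> - 1) * (ml_coeff \<nu> \<beta> r * (x powr \<nu>) ^ r)"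
proof -
  have "x powr (\<nu> * (\<beta> + real r) - 1) = x powr (\<nu> * \<beta> - 1) * (x powr \<nu>) ^ r"
    using assms by (simp add: powr_realpow[symmetric] powr_powr powr_add[symmetric] algebra_simps)
  then show ?thesis using assms by (simp add: fg_term_def)
qed

lemma mittag_leffler_eq:
  "mittag_leffler \<nu> (\<nu> * \<beta>) \<beta> z = (\<Sum>r. ml_coeff \<nu> \<beta> r * z ^ r)"
proof -
  have "\<beta> \<notin> \<int>\<^sub>\<le>\<^sub>0" using beta_pos by (auto elim!: nonpos_Ints_cases)
  then show ?thesis
    unfolding mittag_leffler_def ml_coeff_def
    by (intro suminf_cong) (simp add: pochhammer_Gamma field_simps)
qed

text \<open>A Gamma integral whose value cancels the Gamma factor in \<open>ml_coeff\<close>. What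
  remains is a term of the binomial series in s^-\<nu>.\<close>

lemma nn_integral_fg_term:
  assumes "0 < s"
  shows "(\<integral>\<^sup>+x. ennreal (fg_term \<nu> \<beta> r x * exp (- (s * x))) \<partial>lborel) =
    ennreal (s powr (- (\<nu> * \<beta>)) * (pochhammer \<beta> r / fact r * (s powr (-\<nu>)) ^ r))"
proof -
  define a where "a = \<nu> * (\<beta> + real r)"
  have a: "0 < a" using nu_pos beta_pos by (simp add: a_def)
  then have G: "0 < Gamma a" by (rule Gamma_real_pos)
  have "(\<integral>\<^sup>+x. ennreal (fg_term \<nu> \<beta> r x * exp (- (s * x))) \<partial>lborel) =
    (\<integral>\<^sup>+x. ennreal (ml_coeff \<nu> \<beta> r) * ennreal (indicator {0<..} x * x powr (a - 1) * exp (- (s * x))) \<partial>lborel)"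
    using ml_coeff_nonneg
    by (intro nn_integral_cong) (simp add: ennreal_mult[symmetric] fg_term_def a_def mult_ac)
  also have "\<dots> = ennreal (ml_coeff \<nu> \<beta> r) * ennreal (Gamma a / s powr a)"
    by (subst nn_integral_cmult) (auto simp: nn_integral_powr_exp[OF a assms])
  also have "\<dots> = ennreal (pochhammer \<beta> r / fact r / s powr a)"
  proof (subst ennreal_mult[symmetric])
    show "ennreal (ml_coeff \<nu> \<beta> r * (Gamma a / s powr a)) = ennreal (pochhammer \<beta> r / fact r / s powr a)"
      using G by (simp add: ml_coeff_def flip: a_def)
  qed (use ml_coeff_nonneg G in auto)
  also have "1 / s powr a = s powr (- (\<nu> * \<beta>)) * (s powr (-\<nu>)) ^ r"
    using assms
    by (simp add: a_def powr_realpow[symmetric] powr_powr powr_minus_divide[symmetric] powr_add[symmetric] algebra_simps)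
  then have "pochhammer \<beta> r / fact r / s powr a = s powr (- (\<nu> * \<beta>)) * (pochhammer \<beta> r / fact r * (s powr (-\<nu>)) ^ r)"
    by (metis (no_types, opaque_lifting) mult.left_commute mult.right_neutral times_divide_eq_right)
  finally show ?thesis .
qed

lemma powr_neg_lt_1: "1 < s \<Longrightarrow> s powr (-\<nu>) < 1"
  using nu_pos by (simp add: powr_less_one)

text \<open>Without signs the binomial series is taken at +s^-\<nu>, hence the restriction to s >
  1.\<close>

lemma suminf_nn_integral_fg_term:
  assumes "1 < s"
  shows "(\<Sum>r. \<integral>\<^sup>+x. ennreal (fg_term \<nu> \<beta> r x * exp (- (s * x))) \<partial>lborel) < \<infinity>"
proof -
  have "(\<lambda>r. s powr (- (\<nu> * \<beta>)) * (pochhammer \<beta> r / fact r * (s powr (-\<nu>)) ^ r)) sums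
      (s powr (- (\<nu> * \<beta>)) * (1 - s powr (-\<nu>)) powr (-\<beta>))"
    using powr_neg_lt_1[OF assms] by (intro sums_mult pochhammer_div_fact_sums) simp
  then show ?thesis
    using assms beta_pos
    by (simp add: nn_integral_fg_term suminf_ennreal_eq[where x = "s powr (- (\<nu> * \<beta>)) * (1 - s powr (-\<nu>)) powr (-\<beta>)"]
        pochhammer_ge_zero)
qed

text \<open>
  Convergence for arbitrarily large arguments comes for free: the Laplace integral of the sum of
  the absolute terms is finite, so the sum is finite almost everywhere.
\<close>

lemma summable_ml_coeff: "summable (\<lambda>r. \<bar>ml_coeff \<nu> \<beta> r * z ^ r\<bar>)"
proof -
  have "(\<integral>\<^sup>+x. (\<Sum>r. ennreal (fg_term \<nu> \<beta> r x * exp (- (2 * x)))) \<partial>lborel) < \<infinity>"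
    by (subst nn_integral_suminf) (use suminf_nn_integral_fg_term[of 2] in auto)
  then have "AE x in lborel. (\<Sum>r. ennreal (fg_term \<nu> \<beta> r x * exp (- (2 * x)))) \<noteq> \<infinity>"
    by (intro nn_integral_PInf_AE) auto
  \<comment> \<open>The choice gives y^\<nu> = 1 + |z|. The half-line beyond \<open>y\<close> is not
    a null set, so the unsigned series converges at some x > y, and \<open>z\<close> lies strictly
    inside the disc of radius x^\<nu>.\<close>
  moreover define y where "y = (1 + \<bar>z\<bar>) powr (1 / \<nu>)"
  have "\<not> (AE x in lborel. \<not> y < x)"
  proof
    assume "AE x in lborel. \<not> y < x"
    then have "AE x in lborel. x \<notin> {y<..<y+1}" by eventually_elim auto
    then have "{y<..<y+1} \<in> null_sets lborel" by (subst AE_iff_null_sets) auto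
    then show False by (simp add: null_sets_def)
  qed
  ultimately obtain x where x: "y < x" and fin: "(\<Sum>r. ennreal (fg_term \<nu> \<beta> r x * exp (- (2 * x)))) \<noteq> \<infinity>"
    by (metis (mono_tags, lifting) AE_mp AE_I2)
  have "0 < x" using x by (simp add: y_def) (smt (verit) powr_ge_zero)
  have "summable (\<lambda>r. fg_term \<nu> \<beta> r x * exp (- (2 * x)))"
    using fin fg_term_nonneg by (intro summable_ennrealI) (auto simp: less_top)
  then have "summable (\<lambda>r. fg_term \<nu> \<beta> r x)" by (simp add: summable_cmult_iff mult.commute[of _ "exp _"])
  then have summ: "summable (\<lambda>r. ml_coeff \<nu> \<beta> r * (x powr \<nu>) ^ r)"
    using \<open>0 < x\<close> by (simp add: fg_term_eq summable_cmult_iff)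
  have "y powr \<nu> = 1 + \<bar>z\<bar>" using nu_pos by (simp add: y_def powr_powr)
  moreover have "y powr \<nu> \<le> x powr \<nu>" using x nu_pos by (intro powr_mono2) (auto simp: y_def)
  ultimately have "norm z < norm (x powr \<nu>)" by simp
  from powser_insidea[OF summ this] show ?thesis by simp
qed

lemma fg_term_sums: "(\<lambda>r. (-1) ^ r * fg_term \<nu> \<beta> r x) sums fg_density \<nu> \<beta> x"
proof (cases "0 < x")
  case True
  have "summable (\<lambda>r. ml_coeff \<nu> \<beta> r * (- (x powr \<nu>)) ^ r)"
    by (rule summable_rabs_cancel[OF summable_ml_coeff])
  then have "(\<lambda>r. x powr (\<nu> * \<beta> - 1) * (ml_coeff \<nu> \<beta> r * (- (x powr \<nu>)) ^ r)) sums fg_density \<nu> \<beta> x"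
    using True by (simp add: fg_density_def mittag_leffler_eq sums_mult summable_sums)
  moreover have "x powr (\<nu> * \<beta> - 1) * (ml_coeff \<nu> \<beta> r * (- (x powr \<nu>)) ^ r) = (-1) ^ r * fg_term \<nu> \<beta> r x" for r
    using True by (simp add: fg_term_eq power_minus[of "x powr \<nu>"])
  ultimately show ?thesis by simp
qed (simp add: fg_term_def fg_density_def)

text \<open>Inversion determines the sign at a point only through nearby values, so continuity turns
  it into a pointwise statement. The origin is excluded because the power of \<open>x\<close> may
  blow up there.\<close>

lemma continuous_on_fg_density: "continuous_on {0<..} (fg_density \<nu> \<beta>)"
proof -
  have "isCont (\<lambda>z. \<Sum>r. ml_coeff \<nu> \<beta> r * z ^ r) z" for z
    by (rule isCont_powser[of _ "\<bar>z\<bar> + 1"]) (auto intro: summable_rabs_cancel[OF summable_ml_coeff])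
  then have ml: "continuous_on UNIV (\<lambda>z. \<Sum>r. ml_coeff \<nu> \<beta> r * z ^ r)"
    by (simp add: continuous_at_imp_continuous_on)
  have "continuous_on {0<..} (\<lambda>x. x powr (\<nu> * \<beta> - 1) * (\<Sum>r. ml_coeff \<nu> \<beta> r * (- (x powr \<nu>)) ^ r))"
    by (intro continuous_intros continuous_on_compose2[OF ml]) auto
  then show ?thesis
    by (rule continuous_on_eq) (simp add: fg_density_def mittag_leffler_eq)
qed

lemma has_bochner_integral_fg_term:
  assumes "0 < s"
  shows "has_bochner_integral lborel (\<lambda>x. fg_term \<nu> \<beta> r x * exp (- (s * x)))
    (s powr (- (\<nu> * \<beta>)) * (pochhammer \<beta> r / fact r * (s powr (-\<nu>)) ^ r))"
  using nn_integral_fg_term[OF assms] fg_term_nonneg beta_pos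
  by (intro has_bochner_integral_nn_integral) (auto simp: pochhammer_ge_zero)

text \<open>The absolute series, summable for s > 1, justifies termwise integration. With signs the
  binomial series is taken at -s^-\<nu>, and s^(-\<nu>\<beta>) (1 + s^-\<nu>)^-\<beta> simplifies to
  the closed form.\<close>

lemma laplace_large:
  assumes "1 < s"
  shows "has_bochner_integral lborel (\<lambda>x. exp (- (s * x)) * fg_density \<nu> \<beta> x) ((1 + s powr \<nu>) powr (-\<beta>))"
proof -
  define f where "f r x = (-1) ^ r * (fg_term \<nu> \<beta> r x * exp (- (s * x)))" for r x
  define J where "J r = s powr (- (\<nu> * \<beta>)) * (pochhammer \<beta> r / fact r * (s powr (-\<nu>)) ^ r)" for r
  have bi: "has_bochner_integral lborel (\<lambda>x. fg_term \<nu> \<beta> r x * exp (- (s * x))) (J r)" for r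
    unfolding J_def using has_bochner_integral_fg_term[of s r] assms by simp
  have "has_bochner_integral lborel (f r) ((-1) ^ r * J r)" for r
    unfolding f_def by (intro has_bochner_integral_mult_right bi)
  note fi = this[THEN integrable.intros] this[THEN has_bochner_integral_integral_eq]
  have fs: "(\<lambda>r. f r x) sums (exp (- (s * x)) * fg_density \<nu> \<beta> x)" for x
    using sums_mult[OF fg_term_sums, of "exp (- (s * x))" x] by (simp add: f_def mult_ac)
  have nf: "norm (f r x) = fg_term \<nu> \<beta> r x * exp (- (s * x))" for r x
    using fg_term_nonneg by (simp add: f_def abs_mult)
  have sn: "summable (\<lambda>r. norm (f r x))" for x
  proof (cases "0 < x")
    case True
    have "fg_term \<nu> \<beta> r x = x powr (\<nu> * \<beta> - 1) * \<bar>ml_coeff \<nu> \<beta> r * (x powr \<nu>) ^ r\<bar>" for r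
      using True ml_coeff_nonneg by (simp add: fg_term_eq)
    then show ?thesis unfolding nf by (intro summable_mult2) (simp only: summable_mult summable_ml_coeff)
  qed (simp add: nf[unfolded real_norm_def] fg_term_def)
  have "(\<lambda>r. J r) sums (s powr (- (\<nu> * \<beta>)) * (1 - s powr (-\<nu>)) powr (-\<beta>))"
    unfolding J_def using powr_neg_lt_1[OF assms] by (intro sums_mult pochhammer_div_fact_sums) simp
  then have "summable (\<lambda>r. \<integral>x. norm (f r x) \<partial>lborel)"
    unfolding nf using bi[THEN has_bochner_integral_integral_eq] by (simp add: sums_iff)
  note S = fi(1) AE_I2[OF sn] this
  have eq: "(\<lambda>x. \<Sum>r. f r x) = (\<lambda>x. exp (- (s * x)) * fg_density \<nu> \<beta> x)"
    using fs by (simp add: sums_iff fun_eq_iff)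
  have "(\<lambda>r. s powr (- (\<nu> * \<beta>)) * (pochhammer \<beta> r / fact r * (- (s powr (-\<nu>))) ^ r)) sums
      (s powr (- (\<nu> * \<beta>)) * (1 - - (s powr (-\<nu>))) powr (-\<beta>))"
    using powr_neg_lt_1[OF assms] by (intro sums_mult pochhammer_div_fact_sums) simp
  moreover have "s powr (- (\<nu> * \<beta>)) * (pochhammer \<beta> r / fact r * (- (s powr (-\<nu>))) ^ r) = (-1) ^ r * J r" for r
    by (simp add: J_def power_minus[of "s powr (-\<nu>)"])
  moreover have "s powr (- (\<nu> * \<beta>)) * (1 - - (s powr (-\<nu>))) powr (-\<beta>) = (1 + s powr \<nu>) powr (-\<beta>)"
  proof -
    have "s powr (- (\<nu> * \<beta>)) = (s powr \<nu>) powr (-\<beta>)" by (simp add: powr_powr)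
    moreover have "s powr \<nu> * (1 - - (s powr (-\<nu>))) = 1 + s powr \<nu>"
      using assms by (simp add: distrib_left powr_add[symmetric])
    ultimately show ?thesis by (metis powr_mult)
  qed
  ultimately have "(\<lambda>r. (-1) ^ r * J r) sums ((1 + s powr \<nu>) powr (-\<beta>))" by simp
  moreover have "(\<lambda>r. (-1) ^ r * J r) sums (\<integral>x. exp (- (s * x)) * fg_density \<nu> \<beta> x \<partial>lborel)"
    using sums_integral[OF S] unfolding eq fi(2) by simp
  ultimately have "(\<integral>x. exp (- (s * x)) * fg_density \<nu> \<beta> x \<partial>lborel) = (1 + s powr \<nu>) powr (-\<beta>)"
    by (rule sums_unique2[symmetric])
  then show ?thesis
    using integrable_suminf[OF S] unfolding eq by (simp add: has_bochner_integral_iff)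
qed

end

section \<open>Moments of a function as Taylor coefficients of its Laplace transform, and Laplace's
  method\<close>

text \<open>Expand exp(t x) under the integral. Since \<open>g\<close> lives on x > 0, the absolute
  terms sum to exp(|t| x) times the tilted |g|, which is the integrable majorant \<open>E\<close>.
  It dominates each single term as well, whence integrability of the moments. No sign of
  \<open>g\<close> is assumed, as the result is used before nonnegativity is known.\<close>

lemma laplace_expansion:
  fixes g :: "real \<Rightarrow> real"
  assumes [measurable]: "g \<in> borel_measurable borel"
    and g0: "\<And>x. x \<le> 0 \<Longrightarrow> g x = 0"
    and int: "integrable lborel (\<lambda>x. exp (- ((c - \<bar>t\<bar>) * x)) * g x)"
  shows laplace_expansion_integrable: "t \<noteq> 0 \<Longrightarrow> integrable lborel (\<lambda>x. x ^ k * exp (- (c * x)) * g x)"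
    and laplace_expansion_sums: "(\<lambda>k. (\<integral>x. x ^ k * exp (- (c * x)) * g x \<partial>lborel) / fact k * t ^ k) sums
      (\<integral>x. exp (- ((c - t) * x)) * g x \<partial>lborel)"
proof -
  define f where "f k x = (t * x) ^ k / fact k * (exp (- (c * x)) * g x)" for k x
  have [measurable]: "f k \<in> borel_measurable borel" for k unfolding f_def by measurable
  define E where "E x = norm (exp (- ((c - \<bar>t\<bar>) * x)) * g x)" for x
  have E: "integrable lborel E" unfolding E_def using int by (rule integrable_norm)
  have fsum: "(\<lambda>k. f k x) sums (exp (- ((c - t) * x)) * g x)" for x
  proof -
    have "(\<lambda>k. (t * x) ^ k / fact k * (exp (- (c * x)) * g x)) sums (exp (t * x) * (exp (- (c * x)) * g x))"
      using exp_converges[of "t * x"] by (intro sums_mult2) (simp add: field_simps)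
    moreover have "exp (t * x) * (exp (- (c * x)) * g x) = exp (- ((c - t) * x)) * g x"
      by (simp add: exp_add[symmetric] mult.assoc[symmetric] left_diff_distrib)
    ultimately show ?thesis by (simp add: f_def)
  qed
  have nsum: "(\<lambda>k. norm (f k x)) sums E x" for x
  proof (cases "0 < x")
    case True
    have "(\<lambda>k. (\<bar>t\<bar> * x) ^ k / fact k * (exp (- (c * x)) * \<bar>g x\<bar>)) sums (exp (\<bar>t\<bar> * x) * (exp (- (c * x)) * \<bar>g x\<bar>))"
      using exp_converges[of "\<bar>t\<bar> * x"] by (intro sums_mult2) (simp add: field_simps)
    moreover have "exp (\<bar>t\<bar> * x) * (exp (- (c * x)) * \<bar>g x\<bar>) = E x"
      by (simp add: E_def abs_mult exp_add[symmetric] mult.assoc[symmetric] left_diff_distrib)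
    ultimately show ?thesis using True by (simp add: f_def abs_mult power_abs)
  qed (simp add: f_def E_def g0)
  have le: "norm (f k x) \<le> E x" for k x
    using sum_le_suminf[of "\<lambda>k. norm (f k x)" "{k}"] nsum[of x] by (auto simp: sums_iff)
  have fi: "integrable lborel (f k)" for k
    by (rule Bochner_Integration.integrable_bound[OF E]) (use le in \<open>auto simp: E_def\<close>)
  have fi_eq: "f k x = t ^ k / fact k * (x ^ k * exp (- (c * x)) * g x)" for k x
    by (simp add: f_def power_mult_distrib)
  show "integrable lborel (\<lambda>x. x ^ k * exp (- (c * x)) * g x)" if "t \<noteq> 0"
    using integrable_mult_right[OF fi[of k], of "fact k / t ^ k"] that by (simp add: fi_eq field_simps)
  have "summable (\<lambda>k. \<integral>x. norm (f k x) \<partial>lborel)"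
  proof (rule summableI_nonneg_bounded)
    fix n
    have "(\<Sum>k<n. \<integral>x. norm (f k x) \<partial>lborel) = (\<integral>x. (\<Sum>k<n. norm (f k x)) \<partial>lborel)"
      using fi by (intro Bochner_Integration.integral_sum[symmetric]) auto
    also have "\<dots> \<le> (\<integral>x. E x \<partial>lborel)"
    proof (rule integral_mono)
      fix x show "(\<Sum>k<n. norm (f k x)) \<le> E x"
        using sum_le_suminf[of "\<lambda>k. norm (f k x)" "{..<n}"] nsum[of x] by (auto simp: sums_iff)
    qed (use fi E in auto)
    finally show "(\<Sum>k<n. \<integral>x. norm (f k x) \<partial>lborel) \<le> (\<integral>x. E x \<partial>lborel)" .
  qed auto
  from sums_integral[OF fi _ this] nsum
  have "(\<lambda>k. \<integral>x. f k x \<partial>lborel) sums (\<integral>x. (\<Sum>k. f k x) \<partial>lborel)" by (auto simp: sums_iff)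
  moreover have "(\<Sum>k. f k x) = exp (- ((c - t) * x)) * g x" for x using fsum by (simp add: sums_iff)
  moreover have "(\<integral>x. f k x \<partial>lborel) = (\<integral>x. x ^ k * exp (- (c * x)) * g x \<partial>lborel) / fact k * t ^ k" for k
    unfolding fi_eq by simp
  ultimately show "(\<lambda>k. (\<integral>x. x ^ k * exp (- (c * x)) * g x \<partial>lborel) / fact k * t ^ k) sums
      (\<integral>x. exp (- ((c - t) * x)) * g x \<partial>lborel)" by simp
qed

text \<open>The product condition says that \<open>v\<close> lies between \<open>u\<close> and 1, so
  both branches of the unimodal function u exp(1 - u) are covered at once. The proof is the tangent
  bound for exp at u - v.\<close>

lemma mult_exp_minus_mono:
  fixes u v :: real
  assumes "0 < u" "0 < v" "0 \<le> (v - u) * (1 - v)"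
  shows "u * exp (1 - u) \<le> v * exp (1 - v)"
proof -
  have "u \<le> v * (1 + (u - v))" using assms(3) by (simp add: algebra_simps)
  also have "\<dots> \<le> v * exp (u - v)" using assms by (intro mult_left_mono exp_ge_add_one_self) auto
  finally have "u * exp (1 - u) \<le> v * exp (u - v) * exp (1 - u)" by (intro mult_right_mono) auto
  then show ?thesis by (simp add: mult.assoc exp_add[symmetric])
qed

text \<open>Equality in ln u \<le> u - 1 holds only at 1. The strictness separates the kernel from
  its peak value away from the peak.\<close>

lemma mult_exp_minus_less_1:
  fixes u :: real
  assumes "0 < u" "u \<noteq> 1"
  shows "u * exp (1 - u) < 1"
proof -
  have "ln u < u - 1" using assms ln_le_minus_one[of u] ln_eq_minus_one[of u] by force
  then have "exp (ln u + (1 - u)) < exp 0" by (intro exp_less_mono) simp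
  then show ?thesis using assms by (simp add: exp_add)
qed

text \<open>
  Laplace's method: the kernel \<open>(y / x exp (1 - y / x)) ^ k\<close> concentrates at \<open>y = x\<close> for large \<open>k\<close>,
  and its integral against \<open>g\<close> is, up to a positive factor, the \<open>k\<close>-th moment at \<open>k / x\<close>.
\<close>

lemma nonneg_if_laplace_moments_nonneg:
  fixes g :: "real \<Rightarrow> real"
  assumes g0: "\<And>x. x \<le> 0 \<Longrightarrow> g x = 0"
    and cont: "continuous_on {0<..} g"
    and int: "\<And>c k. a < c \<Longrightarrow> integrable lborel (\<lambda>x. x ^ k * exp (- (c * x)) * g x)"
    and mom: "\<And>c k. a < c \<Longrightarrow> 0 \<le> (\<integral>x. x ^ k * exp (- (c * x)) * g x \<partial>lborel)"
  shows "0 \<le> g x"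
proof (rule ccontr)
  assume neg: "\<not> 0 \<le> g x"
  then have x: "0 < x" using g0[of x] by force
  define \<eta> where "\<eta> = - g x / 2"
  have \<eta>: "0 < \<eta>" using neg by (simp add: \<eta>_def)
  define \<psi> where "\<psi> y = (y / x) * exp (1 - y / x)" for y
  have \<psi>x: "\<psi> x = 1" using x by (simp add: \<psi>_def)
  have \<psi>pos: "0 \<le> \<psi> y" if "0 < y" for y using that x by (simp add: \<psi>_def)
  have "isCont g x" using cont x by (simp add: continuous_on_eq_continuous_at)
  then obtain d where d: "0 < d" "\<And>y. \<bar>y - x\<bar> < d \<Longrightarrow> \<bar>g y - g x\<bar> < \<eta>"
    using \<eta> unfolding continuous_at_eps_delta by (auto simp: dist_real_def)
  define \<delta> where "\<delta> = min (d / 2) (x / 2)"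
  have \<delta>: "0 < \<delta>" "\<delta> < x" "\<delta> < d" using d x by (auto simp: \<delta>_def)
  have gneg: "g y \<le> - \<eta>" if "\<bar>y - x\<bar> \<le> \<delta>" for y
    using d(2)[of y] that \<delta> by (auto simp: \<eta>_def abs_if split: if_splits)
  \<comment> \<open>By unimodality the kernel outside the \<delta>-neighbourhood is largest at the
    two endpoints.\<close>
  define \<rho> where "\<rho> = max (\<psi> (x - \<delta>)) (\<psi> (x + \<delta>))"
  have "\<psi> y < 1" if "0 < y" "y \<noteq> x" for y
    using that x unfolding \<psi>_def by (intro mult_exp_minus_less_1) auto
  then have \<rho>1: "\<rho> < 1" using \<delta> x by (simp add: \<rho>_def)
  have \<rho>0: "0 < \<rho>" using \<delta> x by (simp add: \<rho>_def \<psi>_def less_max_iff_disj)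
  have out: "\<psi> y \<le> \<rho>" if "0 < y" "\<delta> \<le> \<bar>y - x\<bar>" for y
  proof (cases "y \<le> x")
    case True
    then have "0 \<le> ((x - \<delta>) / x - y / x) * (1 - (x - \<delta>) / x)"
      using that \<delta> x by (intro mult_nonneg_nonneg) (auto simp flip: diff_divide_distrib)
    then have "\<psi> y \<le> \<psi> (x - \<delta>)" using that \<delta> x unfolding \<psi>_def
      by (intro mult_exp_minus_mono) auto
    then show ?thesis by (simp add: \<rho>_def)
  next
    case False
    then have "0 \<le> ((x + \<delta>) / x - y / x) * (1 - (x + \<delta>) / x)"
      using that \<delta> x by (intro mult_nonpos_nonpos) (auto simp: divide_le_0_iff simp flip: diff_divide_distrib)
    then have "\<psi> y \<le> \<psi> (x + \<delta>)" using that \<delta> x unfolding \<psi>_def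
      by (intro mult_exp_minus_mono) auto
    then show ?thesis by (simp add: \<rho>_def)
  qed
  \<comment> \<open>A level strictly between the outer bound \<open>\<rho>\<close> and the peak 1;
    the kernel stays above it on the smaller \<epsilon>-neighbourhood.\<close>
  define \<sigma> where "\<sigma> = (1 + \<rho>) / 2"
  have \<sigma>: "\<rho> < \<sigma>" "\<sigma> < 1" "0 < \<sigma>" using \<rho>1 \<rho>0 by (auto simp: \<sigma>_def)
  have "isCont \<psi> x" unfolding \<psi>_def using x by (intro continuous_intros) auto
  then obtain e where e: "0 < e" "\<And>y. \<bar>y - x\<bar> < e \<Longrightarrow> \<bar>\<psi> y - 1\<bar> < 1 - \<sigma>"
    using \<sigma> \<psi>x unfolding continuous_at_eps_delta by (auto simp: dist_real_def) (meson diff_gt_0_iff_gt)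
  define \<epsilon> where "\<epsilon> = min e \<delta>"
  have \<epsilon>: "0 < \<epsilon>" "\<epsilon> \<le> \<delta>" "\<epsilon> \<le> e" using e \<delta> by (auto simp: \<epsilon>_def)
  have inn: "\<sigma> \<le> \<psi> y" if "\<bar>y - x\<bar> < \<epsilon>" for y using e(2)[of y] that \<epsilon> by (auto simp: abs_if split: if_splits)
  obtain K where K: "max a 0 * x < real K" using reals_Archimedean2 by blast
  have kern: "\<psi> y ^ k * g y = (exp 1 / x) ^ k * (y ^ k * exp (- (real k / x * y)) * g y)" for k y
    by (simp add: \<psi>_def exp_diff power_mult_distrib power_divide exp_minus field_simps exp_of_nat_mult[symmetric])
  have big: "a < real k / x" if "K \<le> k" for k
  proof -
    have "a * x \<le> max a 0 * x" using x by (intro mult_right_mono) auto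
    also have "\<dots> < real k" using K that by (meson less_le_trans of_nat_le_iff)
    finally show ?thesis using x by (simp add: field_simps)
  qed
  have ki: "integrable lborel (\<lambda>y. \<psi> y ^ k * g y)" if "K \<le> k" for k
    unfolding kern using int[OF big[OF that]] by (intro integrable_mult_right) auto
  have k0: "0 \<le> (\<integral>y. \<psi> y ^ k * g y \<partial>lborel)" if "K \<le> k" for k
    unfolding kern using mom[OF big[OF that], of k] x by simp
  \<comment> \<open>Only the products of \<open>g\<close> with kernel powers are known to be
    integrable, so \<open>K\<close> factors of the kernel stay with \<open>g\<close> and only the
    remaining k - K are estimated by \<open>\<rho>\<close>.\<close>
  define A where "A = (\<integral>y. \<bar>\<psi> y ^ K * g y\<bar> \<partial>lborel)"
  \<comment> \<open>The inner neighbourhood contributes at most -2\<epsilon>\<eta>\<sigma>^k, the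
    ring between \<epsilon> and \<delta> nothing positive, and the outside at most \<rho>^(k-K) A.
    As the total is nonnegative, (\<sigma>/\<rho>)^k stays bounded, although \<sigma>/\<rho> >
    1.\<close>
  have bound: "(\<sigma> / \<rho>) ^ k \<le> A / (2 * \<epsilon> * \<eta> * \<rho> ^ K)" if "K \<le> k" for k
  proof -
    have Ai: "integrable lborel (\<lambda>y. \<bar>\<psi> y ^ K * g y\<bar>)" using ki[of K] by auto
    have Ii: "integrable lborel (indicat_real {x-\<epsilon><..<x+\<epsilon>})"
      using \<epsilon> by (intro integrable_real_indicator) auto
    have "0 \<le> (\<integral>y. \<psi> y ^ k * g y \<partial>lborel)" using k0[OF that] .
    also have "\<dots> \<le> (\<integral>y. \<rho> ^ (k - K) * \<bar>\<psi> y ^ K * g y\<bar> - \<eta> * \<sigma> ^ k * indicator {x-\<epsilon><..<x+\<epsilon>} y \<partial>lborel)"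
    proof (rule integral_mono[OF ki[OF that]])
      fix y
      show "\<psi> y ^ k * g y \<le> \<rho> ^ (k - K) * \<bar>\<psi> y ^ K * g y\<bar> - \<eta> * \<sigma> ^ k * indicator {x-\<epsilon><..<x+\<epsilon>} y"
      proof (cases "0 < y")
        case False
        then show ?thesis using g0[of y] \<epsilon> \<delta> by (auto simp: indicator_def)
      next
        case y: True
        have R: "0 \<le> \<rho> ^ (k - K) * \<bar>\<psi> y ^ K * g y\<bar>" using \<rho>0 by simp
        consider "\<bar>y - x\<bar> < \<epsilon>" | "\<epsilon> \<le> \<bar>y - x\<bar>" "\<bar>y - x\<bar> \<le> \<delta>" | "\<delta> < \<bar>y - x\<bar>" by linarith
        then show ?thesis
        proof cases
          case 1
          have "\<sigma> ^ k * \<eta> \<le> \<psi> y ^ k * (- g y)"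
            using inn[OF 1] gneg[of y] 1 \<epsilon> \<sigma> \<eta> \<psi>pos[OF y] by (intro mult_mono power_mono) auto
          moreover have "y \<in> {x-\<epsilon><..<x+\<epsilon>}" using 1 by (auto simp: abs_if split: if_splits)
          ultimately show ?thesis using R by (simp add: mult.commute)
        next
          case 2
          have "\<psi> y ^ k * g y \<le> 0" using gneg[OF 2(2)] \<eta> \<psi>pos[OF y] by (intro mult_nonneg_nonpos) auto
          moreover have "y \<notin> {x-\<epsilon><..<x+\<epsilon>}" using 2 by (auto simp: abs_if split: if_splits)
          ultimately show ?thesis using R by simp
        next
          case 3
          have "\<psi> y ^ k = \<psi> y ^ (k - K) * \<psi> y ^ K" using that by (simp flip: power_add)
          also have "\<dots> \<le> \<rho> ^ (k - K) * \<psi> y ^ K"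
            using out[OF y] 3 \<psi>pos[OF y] by (intro mult_right_mono power_mono) auto
          finally have "\<psi> y ^ k * \<bar>g y\<bar> \<le> \<rho> ^ (k - K) * \<psi> y ^ K * \<bar>g y\<bar>" by (intro mult_right_mono) auto
          moreover have "\<psi> y ^ k * g y \<le> \<psi> y ^ k * \<bar>g y\<bar>" using \<psi>pos[OF y] by (intro mult_left_mono) auto
          moreover have "y \<notin> {x-\<epsilon><..<x+\<epsilon>}" using 3 \<epsilon> by (auto simp: abs_if split: if_splits)
          ultimately show ?thesis using \<psi>pos[OF y] by (simp add: abs_mult power_abs mult.assoc)
        qed
      qed
    qed (use Ai Ii in auto)
    also have "\<dots> = \<rho> ^ (k - K) * A - \<eta> * \<sigma> ^ k * (2 * \<epsilon>)"
      using Ai Ii \<epsilon> by (subst Bochner_Integration.integral_diff) (auto simp: A_def)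
    finally have "2 * \<epsilon> * \<eta> * \<sigma> ^ k \<le> \<rho> ^ (k - K) * A" by (simp add: mult_ac)
    also have "\<rho> ^ (k - K) = \<rho> ^ k / \<rho> ^ K" using that \<rho>0 by (simp add: power_diff)
    finally show ?thesis using \<epsilon> \<eta> \<rho>0 by (simp add: field_simps power_divide)
  qed
  have "1 < \<sigma> / \<rho>" using \<sigma> \<rho>0 by (simp add: field_simps)
  then obtain n where n: "A / (2 * \<epsilon> * \<eta> * \<rho> ^ K) < (\<sigma> / \<rho>) ^ n" using real_arch_pow by blast
  also have "\<dots> \<le> (\<sigma> / \<rho>) ^ (max n K)" using \<open>1 < \<sigma> / \<rho>\<close> by (intro power_increasing) auto
  also have "\<dots> \<le> A / (2 * \<epsilon> * \<eta> * \<rho> ^ K)" by (rule bound) simp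
  finally show False by simp
qed

section \<open>Sign of the fractional Gamma density, its Laplace transform and moments for all s >
  0\<close>

context fractional_gamma
begin

lemma fg_density_eq_0: "x \<le> 0 \<Longrightarrow> fg_density \<nu> \<beta> x = 0"
  by (simp add: fg_density_def)

text \<open>For s > 0 this is (-1)^k times the k-th derivative of the Laplace transform at
  s.\<close>

definition moment :: "nat \<Rightarrow> real \<Rightarrow> real" where
  "moment k s = (\<integral>x. x ^ k * exp (- (s * x)) * fg_density \<nu> \<beta> x \<partial>lborel)"

text \<open>Moving by half the gap (c - 1)/2 keeps the tilt above 1, where the Laplace integral is
  already known to converge.\<close>

lemma moment_integrable_large:
  assumes "1 < c"
  shows "integrable lborel (\<lambda>x. x ^ k * exp (- (c * x)) * fg_density \<nu> \<beta> x)"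
proof (rule laplace_expansion_integrable[where t = "(c - 1) / 2"])
  show "integrable lborel (\<lambda>x. exp (- ((c - \<bar>(c - 1) / 2\<bar>) * x)) * fg_density \<nu> \<beta> x)"
  proof (rule integrable.intros, rule laplace_large)
    show "1 < c - \<bar>(c - 1) / 2\<bar>"
      using assms by (subst abs_of_nonneg) (simp_all add: field_simps)
  qed
qed (use assms in \<open>simp_all add: fg_density_eq_0\<close>)

text \<open>Both claims follow from identifying the moments with the coefficients of the nonnegative
  series: the sign directly, and the range t < c because that series converges there, beyond the
  range t < c - 1 in which the integral expansion was derived.\<close>

lemma moment_large:
  assumes "1 < c"
  shows moment_nonneg_large: "0 \<le> moment k c"
    and moment_sums_large: "\<And>t. 0 \<le> t \<Longrightarrow> t < c \<Longrightarrow>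
      (\<lambda>k. moment k c / fact k * t ^ k) sums ((1 + (c - t) powr \<nu>) powr (-\<beta>))"
proof -
  obtain a where a: "\<And>k. 0 \<le> a k"
    and as: "\<And>t. 0 \<le> t \<Longrightarrow> t < c \<Longrightarrow> (\<lambda>k. a k * t ^ k) sums ((1 + (c - t) powr \<nu>) powr (-\<beta>))"
    using nonneg_power_series_fractional_gamma_laplace[of \<nu> \<beta> c] nu_pos nu_le beta_pos assms
    unfolding nonneg_power_series_def by auto
  have "(\<lambda>k. moment k c / fact k) = a"
  proof (rule power_series_coeffs_unique)
    show "0 < c - 1" using assms by simp
    fix t assume t: "0 \<le> t" "t < c - 1"
    then have L: "has_bochner_integral lborel (\<lambda>x. exp (- ((c - t) * x)) * fg_density \<nu> \<beta> x)
      ((1 + (c - t) powr \<nu>) powr (-\<beta>))"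
      by (intro laplace_large) auto
    show "(\<lambda>k. moment k c / fact k * t ^ k) sums ((1 + (c - t) powr \<nu>) powr (-\<beta>))"
    proof -
      have "integrable lborel (\<lambda>x. exp (- ((c - \<bar>t\<bar>) * x)) * fg_density \<nu> \<beta> x)"
        using integrable.intros[OF L] t by simp
      from laplace_expansion_sums[OF _ fg_density_eq_0 this] show ?thesis
        unfolding has_bochner_integral_integral_eq[OF L] moment_def by simp
    qed
    show "(\<lambda>k. a k * t ^ k) sums ((1 + (c - t) powr \<nu>) powr (-\<beta>))" using t by (intro as) auto
  qed
  then have eq: "moment k c / fact k = a k" for k by (rule fun_cong)
  have "moment k c = fact k * a k" by (simp flip: eq)
  then show "0 \<le> moment k c" using a by simp
  show "(\<lambda>k. moment k c / fact k * t ^ k) sums ((1 + (c - t) powr \<nu>) powr (-\<beta>))"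
    if "0 \<le> t" "t < c" for t unfolding eq using as that .
qed

lemma fg_density_nonneg: "0 \<le> fg_density \<nu> \<beta> x"
  by (rule nonneg_if_laplace_moments_nonneg[where a = 1])
    (simp_all add: fg_density_eq_0 continuous_on_fg_density moment_integrable_large
      moment_nonneg_large[unfolded moment_def])

lemma laplace:
  assumes "0 < s"
  shows "has_bochner_integral lborel (\<lambda>x. exp (- (s * x)) * fg_density \<nu> \<beta> x) ((1 + s powr \<nu>) powr (-\<beta>))"
proof -
  \<comment> \<open>Any c > 1 above s would do. The displacement c - s is positive, and it is below
    c because s > 0.\<close>
  define c where "c = s + 2"
  have c: "1 < c" "0 \<le> c - s" "c - s < c" using assms by (auto simp: c_def)
  have pos: "0 \<le> x ^ k * exp (- (c * x)) * fg_density \<nu> \<beta> x" for k x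
    using fg_density_nonneg fg_density_eq_0[of x] by (cases "0 < x") auto
  have "(\<integral>\<^sup>+x. ennreal (exp (- (s * x)) * fg_density \<nu> \<beta> x) \<partial>lborel) =
    (\<integral>\<^sup>+x. (\<Sum>k. ennreal ((c - s) ^ k / fact k * (x ^ k * exp (- (c * x)) * fg_density \<nu> \<beta> x))) \<partial>lborel)"
  proof (intro nn_integral_cong suminf_ennreal_eq[symmetric])
    fix x :: real
    have S: "(\<lambda>k. ((c - s) * x) ^ k / fact k * (exp (- (c * x)) * fg_density \<nu> \<beta> x)) sums
      (exp ((c - s) * x) * (exp (- (c * x)) * fg_density \<nu> \<beta> x))"
      using exp_converges[of "(c - s) * x"] by (intro sums_mult2) (simp add: field_simps)
    have eq: "exp ((c - s) * x) * (exp (- (c * x)) * fg_density \<nu> \<beta> x) = exp (- (s * x)) * fg_density \<nu> \<beta> x"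
      by (simp add: mult.assoc[symmetric] exp_add[symmetric] left_diff_distrib)
    from S show "(\<lambda>k. (c - s) ^ k / fact k * (x ^ k * exp (- (c * x)) * fg_density \<nu> \<beta> x)) sums
      (exp (- (s * x)) * fg_density \<nu> \<beta> x)"
      unfolding eq by (simp add: power_mult_distrib mult_ac)
  qed (use pos c in auto)
  also have "\<dots> = (\<Sum>k. \<integral>\<^sup>+x. ennreal ((c - s) ^ k / fact k * (x ^ k * exp (- (c * x)) * fg_density \<nu> \<beta> x)) \<partial>lborel)"
    by (rule nn_integral_suminf) auto
  also have "\<dots> = (\<Sum>k. ennreal (moment k c / fact k * (c - s) ^ k))"
  proof (rule suminf_cong)
    fix k
    have "(\<integral>\<^sup>+x. ennreal ((c - s) ^ k / fact k * (x ^ k * exp (- (c * x)) * fg_density \<nu> \<beta> x)) \<partial>lborel) =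
      ennreal (\<integral>x. (c - s) ^ k / fact k * (x ^ k * exp (- (c * x)) * fg_density \<nu> \<beta> x) \<partial>lborel)"
      using c pos
      by (intro nn_integral_eq_integral integrable_mult_right moment_integrable_large AE_I2 mult_nonneg_nonneg[OF _ pos]) auto
    also have "\<dots> = ennreal (moment k c / fact k * (c - s) ^ k)"
      unfolding Bochner_Integration.integral_mult_right_zero moment_def[symmetric]
      by (simp add: mult.commute)
    finally show "(\<integral>\<^sup>+x. ennreal ((c - s) ^ k / fact k * (x ^ k * exp (- (c * x)) * fg_density \<nu> \<beta> x)) \<partial>lborel) =
      ennreal (moment k c / fact k * (c - s) ^ k)" .
  qed
  also have "\<dots> = ennreal ((1 + (c - (c - s)) powr \<nu>) powr (-\<beta>))"
    using moment_sums_large[OF c] moment_nonneg_large[OF c(1)] c by (intro suminf_ennreal_eq) auto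
  finally show ?thesis
    using fg_density_nonneg by (intro has_bochner_integral_nn_integral) auto
qed

lemma moment_integrable:
  assumes "0 < s"
  shows "integrable lborel (\<lambda>x. x ^ k * exp (- (s * x)) * fg_density \<nu> \<beta> x)"
proof (rule laplace_expansion_integrable[where t = "s / 2"])
  show "integrable lborel (\<lambda>x. exp (- ((s - \<bar>s / 2\<bar>) * x)) * fg_density \<nu> \<beta> x)"
    by (rule integrable.intros, rule laplace) (use assms in auto)
qed (use assms in \<open>simp_all add: fg_density_eq_0\<close>)

lemma moment_sums:
  assumes "norm t < s"
  shows "(\<lambda>k. moment k s / fact k * t ^ k) sums ((1 + (s - t) powr \<nu>) powr (-\<beta>))"
proof -
  have "integrable lborel (\<lambda>x. exp (- ((s - \<bar>t\<bar>) * x)) * fg_density \<nu> \<beta> x)"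
    by (rule integrable.intros, rule laplace) (use assms in auto)
  from laplace_expansion_sums[OF _ fg_density_eq_0 this]
  show ?thesis
    using has_bochner_integral_integral_eq[OF laplace[of "s - t"]] assms by (simp add: moment_def)
qed

lemma moment_0: "0 < s \<Longrightarrow> moment 0 s = (1 + s powr \<nu>) powr (-\<beta>)"
  using laplace[of s] by (simp add: moment_def has_bochner_integral_iff)

text \<open>The moments are coefficients of the power series of (1 + (s - t)^\<nu>)^-\<beta> in
  \<open>t\<close>, so termwise differentiation of that series replaces differentiation under the
  integral. \<open>D\<close> and \<open>D2\<close> are its derivatives in \<open>t\<close>.\<close>

lemma moment_1_2:
  assumes "0 < s"
  shows moment_1: "moment 1 s = \<beta> * \<nu> * s powr (\<nu> - 1) * (1 + s powr \<nu>) powr (-\<beta> - 1)"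
    and moment_2: "moment 2 s = \<beta> * (\<beta> + 1) * \<nu>\<^sup>2 * s powr (2 * \<nu> - 2) * (1 + s powr \<nu>) powr (-\<beta> - 2) +
      \<beta> * \<nu> * (1 - \<nu>) * s powr (\<nu> - 2) * (1 + s powr \<nu>) powr (-\<beta> - 1)"
proof -
  define D where "D t = \<beta> * \<nu> * (s - t) powr (\<nu> - 1) * (1 + (s - t) powr \<nu>) powr (-\<beta> - 1)" for t
  define D2 where "D2 t = \<beta> * (\<beta> + 1) * \<nu>\<^sup>2 * (s - t) powr (2 * \<nu> - 2) * (1 + (s - t) powr \<nu>) powr (-\<beta> - 2) +
      \<beta> * \<nu> * (1 - \<nu>) * (s - t) powr (\<nu> - 2) * (1 + (s - t) powr \<nu>) powr (-\<beta> - 1)" for t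
  have pos: "0 < 1 + u powr \<nu>" for u by (intro add_pos_nonneg) auto
  have P: "((\<lambda>t. (s - t) powr a) has_field_derivative - (a * (s - t) powr (a - 1))) (at t)"
    if "norm t < s" for a t
    using DERIV_chain2[OF has_real_derivative_powr, of "\<lambda>t. s - t" t "-1" UNIV a] that
    by (auto intro!: derivative_eq_intros)
  have Q: "((\<lambda>t. (1 + (s - t) powr \<nu>) powr b) has_field_derivative
      - (b * \<nu> * (s - t) powr (\<nu> - 1) * (1 + (s - t) powr \<nu>) powr (b - 1))) (at t)" if "norm t < s" for b t
    using DERIV_chain2[OF has_real_derivative_powr DERIV_add[OF DERIV_const P[OF that]], of 1 \<nu> b] pos
    by (simp add: mult_ac)
  have D: "((\<lambda>t. (1 + (s - t) powr \<nu>) powr (-\<beta>)) has_field_derivative D t) (at t)" if "norm t < s" for t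
    using Q[OF that, of "-\<beta>"] by (simp add: D_def)
  have D2: "(D has_field_derivative D2 t) (at t)" if "norm t < s" for t
  proof -
    have "(s - t) powr (2 * \<nu> - 2) = (s - t) powr (\<nu> - 1) * (s - t) powr (\<nu> - 1)"
      by (simp add: powr_add[symmetric])
    moreover have "((\<lambda>t. \<beta> * \<nu> * ((s - t) powr (\<nu> - 1) * (1 + (s - t) powr \<nu>) powr (-\<beta> - 1)))
      has_field_derivative \<beta> * \<nu> *
        (- ((\<nu> - 1) * (s - t) powr (\<nu> - 1 - 1)) * (1 + (s - t) powr \<nu>) powr (-\<beta> - 1) +
         - ((-\<beta> - 1) * \<nu> * (s - t) powr (\<nu> - 1) * (1 + (s - t) powr \<nu>) powr (-\<beta> - 1 - 1)) * (s - t) powr (\<nu> - 1)))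
      (at t)"
      by (intro DERIV_cmult DERIV_mult P Q that)
    ultimately show ?thesis
      unfolding D_def[abs_def] D2_def by (simp add: algebra_simps power2_eq_square)
  qed
  define c where "c k = moment k s / fact k" for k
  have 0: "(\<lambda>k. c k * t ^ k) sums ((1 + (s - t) powr \<nu>) powr (-\<beta>))" if "norm t < s" for t
    using moment_sums[OF that] by (simp add: c_def)
  have 1: "(\<lambda>k. diffs c k * t ^ k) sums D t" if "norm t < s" for t
    by (rule termdiffs_sums_strong[OF _ D[OF that] that]) (rule 0)
  have 2: "(\<lambda>k. diffs (diffs c) k * t ^ k) sums D2 t" if "norm t < s" for t
    by (rule termdiffs_sums_strong[OF _ D2[OF that] that]) (rule 1)
  show "moment 1 s = \<beta> * \<nu> * s powr (\<nu> - 1) * (1 + s powr \<nu>) powr (-\<beta> - 1)"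
  proof -
    have "diffs c 0 = D 0" using 1[of 0] assms by (simp only: powser_sums_zero_iff norm_zero)
    then show ?thesis by (simp add: diffs_def c_def D_def)
  qed
  show "moment 2 s = \<beta> * (\<beta> + 1) * \<nu>\<^sup>2 * s powr (2 * \<nu> - 2) * (1 + s powr \<nu>) powr (-\<beta> - 2) +
      \<beta> * \<nu> * (1 - \<nu>) * s powr (\<nu> - 2) * (1 + s powr \<nu>) powr (-\<beta> - 1)"
  proof -
    \<comment> \<open>Differentiating twice multiplies the coefficient of t^2 by 2, which cancels
      the \<open>fact 2\<close> in \<open>c\<close>.\<close>
    have "diffs (diffs c) 0 = D2 0" using 2[of 0] assms by (simp only: powser_sums_zero_iff norm_zero)
    then show ?thesis by (simp add: diffs_def c_def D2_def numeral_2_eq_2)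
  qed
qed

lemma nn_integral_moment:
  assumes "0 < s"
  shows "(\<integral>\<^sup>+x. ennreal (x ^ k) * ennreal (exp (- (s * x))) * ennreal (fg_density \<nu> \<beta> x) \<partial>lborel) = ennreal (moment k s)"
proof -
  have pos: "0 \<le> x ^ k * exp (- (s * x)) * fg_density \<nu> \<beta> x" for x
    using fg_density_nonneg fg_density_eq_0[of x] by (cases "0 < x") auto
  \<comment> \<open>For x \<le> 0 the coercion may truncate an odd power, but the density vanishes
    there, so both sides are 0.\<close>
  have "ennreal (x ^ k) * ennreal (exp (- (s * x))) * ennreal (fg_density \<nu> \<beta> x) =
    ennreal (x ^ k * exp (- (s * x)) * fg_density \<nu> \<beta> x)" for x
  proof (cases "0 < x")
    case True
    then show ?thesis using fg_density_nonneg by (simp add: ennreal_mult[symmetric])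
  qed (simp add: fg_density_eq_0)
  then show ?thesis
    unfolding moment_def using pos moment_integrable[OF assms]
    by (subst nn_integral_eq_integral[symmetric]) auto
qed

lemma moment_nonneg: "0 \<le> moment k s"
  unfolding moment_def
proof (rule integral_nonneg_AE, rule AE_I2)
  show "0 \<le> x ^ k * exp (- (s * x)) * fg_density \<nu> \<beta> x" for x
    using fg_density_nonneg fg_density_eq_0[of x] by (cases "0 < x") auto
qed

end

subsection \<open>Integrals over the Laplace variable\<close>

lemma nn_integral_FTC_Ioi:
  fixes f F :: "real \<Rightarrow> real"
  assumes F: "\<And>x. 0 < x \<Longrightarrow> DERIV F x :> f x"
    and f: "\<And>x. 0 < x \<Longrightarrow> isCont f x" "\<And>x. 0 < x \<Longrightarrow> 0 \<le> f x"
    and A: "(F \<longlongrightarrow> A) (at_right 0)" and B: "(F \<longlongrightarrow> B) at_top"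
  shows "(\<integral>\<^sup>+x. ennreal (indicator {0<..} x * f x) \<partial>lborel) = ennreal (B - A)"
proof -
  have A': "((F \<circ> real_of_ereal) \<longlongrightarrow> A) (at_right 0)"
    using A by (simp add: ereal_tendsto_simps zero_ereal_def)
  have B': "((F \<circ> real_of_ereal) \<longlongrightarrow> B) (at_left \<infinity>)"
    using B by (simp add: ereal_tendsto_simps)
  have int: "set_integrable lborel (einterval 0 \<infinity>) f"
    by (rule interval_integral_FTC_nonneg(1)[OF _ _ _ _ A' B']) (use F f in auto)
  have val: "(LBINT x=0..\<infinity>. f x) = B - A"
    by (rule interval_integral_FTC_nonneg(2)[OF _ _ _ _ A' B']) (use F f in auto)
  have e: "einterval 0 \<infinity> = {0<..}" by (auto simp: einterval_def zero_ereal_def)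
  have "(\<integral>\<^sup>+x. ennreal (indicator {0<..} x * f x) \<partial>lborel) = ennreal (\<integral>x. indicator {0<..} x * f x \<partial>lborel)"
    using int f(2)
    by (intro nn_integral_eq_integral) (auto simp: e set_integrable_def indicator_def)
  also have "(\<integral>x. indicator {0<..} x * f x \<partial>lborel) = B - A"
    using val by (simp add: interval_lebesgue_integral_def e set_lebesgue_integral_def)
  finally show ?thesis .
qed

lemma one_plus_powr_pos: "0 < 1 + (s::real) powr a"
  by (intro add_pos_nonneg) auto

lemma DERIV_one_plus_powr_powr:
  assumes "0 < (s::real)"
  shows "((\<lambda>s. (1 + s powr \<nu>) powr b) has_field_derivative
    b * (\<nu> * s powr (\<nu> - 1) * (1 + s powr \<nu>) powr (b - 1))) (at s)"
  using DERIV_chain2[OF has_real_derivative_powr DERIV_add[OF DERIV_const has_real_derivative_powr[OF assms]], of 1 \<nu> b]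
    one_plus_powr_pos by (simp add: mult_ac)

lemma tendsto_one_plus_powr_at_right_0:
  assumes "0 < \<nu>"
  shows "((\<lambda>s::real. (1 + s powr \<nu>) powr b) \<longlongrightarrow> 1) (at_right 0)"
proof -
  have "((\<lambda>s::real. s powr \<nu>) \<longlongrightarrow> 0) (at_right 0)"
    using assms by (intro tendsto_zero_powrI[where b = \<nu>]) (auto intro: eventually_at_right_less[THEN eventually_mono] tendsto_ident_at)
  then have "((\<lambda>s::real. (1 + s powr \<nu>) powr b) \<longlongrightarrow> (1 + 0) powr b) (at_right 0)"
    by (intro tendsto_intros) auto
  then show ?thesis by simp
qed

lemma tendsto_one_plus_powr_at_top:
  assumes "0 < \<nu>" "b < 0"
  shows "((\<lambda>s::real. (1 + s powr \<nu>) powr b) \<longlongrightarrow> 0) at_top"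
proof (rule tendsto_neg_powr[OF assms(2)])
  have "filterlim (\<lambda>s::real. s powr \<nu>) at_top at_top"
    using assms(1) by real_asymp
  then show "filterlim (\<lambda>s::real. 1 + s powr \<nu>) at_top at_top"
    by (rule filterlim_tendsto_add_at_top[OF tendsto_const])
qed

text \<open>With u = s^\<nu> these are the Beta values B(1, B) and B(2, B). The first has
  antiderivative -(1 + s^\<nu>)^-B / B; for the second, writing s^\<nu> = (1 + s^\<nu>) - 1 gives a
  difference of two integrals of the first kind, 1/B - 1/(B + 1).\<close>

lemma nn_integral_powr_one_plus_powr:
  fixes \<nu> B :: real
  assumes "0 < \<nu>" "0 < B"
  shows nn_integral_powr_one_plus_powr_1:
      "(\<integral>\<^sup>+s. ennreal (indicator {0<..} s * (\<nu> * s powr (\<nu> - 1) * (1 + s powr \<nu>) powr (-B - 1))) \<partial>lborel) =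
        ennreal (1 / B)"
    and nn_integral_powr_one_plus_powr_2:
      "(\<integral>\<^sup>+s. ennreal (indicator {0<..} s * (\<nu> * s powr (2 * \<nu> - 1) * (1 + s powr \<nu>) powr (-B - 2))) \<partial>lborel) =
        ennreal (1 / (B * (B + 1)))"
proof -
  have "(\<integral>\<^sup>+s. ennreal (indicator {0<..} s * (\<nu> * s powr (\<nu> - 1) * (1 + s powr \<nu>) powr (-B - 1))) \<partial>lborel) =
    ennreal (- (1 / B) * 0 - (- (1 / B) * 1))"
  proof (rule nn_integral_FTC_Ioi)
    fix s :: real assume s: "0 < s"
    show "((\<lambda>s. - (1 / B) * (1 + s powr \<nu>) powr (-B)) has_real_derivative \<nu> * s powr (\<nu> - 1) * (1 + s powr \<nu>) powr (-B - 1)) (at s)"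
      using DERIV_cmult[OF DERIV_one_plus_powr_powr[OF s, of \<nu> "-B"], of "- (1 / B)"] assms by simp
    show "isCont (\<lambda>s. \<nu> * s powr (\<nu> - 1) * (1 + s powr \<nu>) powr (-B - 1)) s"
      using s one_plus_powr_pos[of s \<nu>] by (intro continuous_intros) auto
  next
    show "((\<lambda>s. - (1 / B) * (1 + s powr \<nu>) powr (-B)) \<longlongrightarrow> - (1 / B) * 1) (at_right 0)"
      using assms by (intro tendsto_mult tendsto_const tendsto_one_plus_powr_at_right_0)
    show "((\<lambda>s. - (1 / B) * (1 + s powr \<nu>) powr (-B)) \<longlongrightarrow> - (1 / B) * 0) at_top"
      using assms by (intro tendsto_mult tendsto_const tendsto_one_plus_powr_at_top) auto
  qed (use assms in auto)
  then show "(\<integral>\<^sup>+s. ennreal (indicator {0<..} s * (\<nu> * s powr (\<nu> - 1) * (1 + s powr \<nu>) powr (-B - 1))) \<partial>lborel) =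
        ennreal (1 / B)" by simp
  have "(\<integral>\<^sup>+s. ennreal (indicator {0<..} s * (\<nu> * s powr (2 * \<nu> - 1) * (1 + s powr \<nu>) powr (-B - 2))) \<partial>lborel) =
    ennreal ((- (1 / B) * 0 + 1 / (B + 1) * 0) - (- (1 / B) * 1 + 1 / (B + 1) * 1))"
  proof (rule nn_integral_FTC_Ioi)
    fix s :: real assume s: "0 < s"
    have e2: "-B - 1 - 1 = -B - 2" by simp
    have "(1 + s powr \<nu>) powr (-B - 1) = (1 + s powr \<nu>) * (1 + s powr \<nu>) powr (-B - 2)"
    proof -
      have e: "-B - 1 = 1 + (-B - 2)" by simp
      show ?thesis unfolding e powr_add using one_plus_powr_pos[of s \<nu>] by simp
    qed
    moreover have "s powr (2 * \<nu> - 1) = s powr (\<nu> - 1) * s powr \<nu>" by (simp add: powr_add[symmetric])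
    ultimately have "\<nu> * s powr (2 * \<nu> - 1) * (1 + s powr \<nu>) powr (-B - 2) =
      - (1 / B) * (-B * (\<nu> * s powr (\<nu> - 1) * (1 + s powr \<nu>) powr (-B - 1))) +
      1 / (B + 1) * ((-B - 1) * (\<nu> * s powr (\<nu> - 1) * (1 + s powr \<nu>) powr (-B - 1 - 1)))"
      unfolding e2 using assms by (simp add: divide_simps) (simp add: algebra_simps)
    moreover have "((\<lambda>s. - (1 / B) * (1 + s powr \<nu>) powr (-B) + 1 / (B + 1) * (1 + s powr \<nu>) powr (-B - 1)) has_real_derivative
      - (1 / B) * (-B * (\<nu> * s powr (\<nu> - 1) * (1 + s powr \<nu>) powr (-B - 1))) +
      1 / (B + 1) * ((-B - 1) * (\<nu> * s powr (\<nu> - 1) * (1 + s powr \<nu>) powr (-B - 1 - 1)))) (at s)"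
      by (intro DERIV_add DERIV_cmult DERIV_one_plus_powr_powr s)
    ultimately show "((\<lambda>s. - (1 / B) * (1 + s powr \<nu>) powr (-B) + 1 / (B + 1) * (1 + s powr \<nu>) powr (-B - 1)) has_real_derivative
      \<nu> * s powr (2 * \<nu> - 1) * (1 + s powr \<nu>) powr (-B - 2)) (at s)" by simp
    show "isCont (\<lambda>s. \<nu> * s powr (2 * \<nu> - 1) * (1 + s powr \<nu>) powr (-B - 2)) s"
      using s one_plus_powr_pos[of s \<nu>] by (intro continuous_intros) auto
  next
    show "((\<lambda>s. - (1 / B) * (1 + s powr \<nu>) powr (-B) + 1 / (B + 1) * (1 + s powr \<nu>) powr (-B - 1)) \<longlongrightarrow>
      - (1 / B) * 1 + 1 / (B + 1) * 1) (at_right 0)"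
      using assms by (intro tendsto_add tendsto_mult tendsto_const tendsto_one_plus_powr_at_right_0)
    show "((\<lambda>s. - (1 / B) * (1 + s powr \<nu>) powr (-B) + 1 / (B + 1) * (1 + s powr \<nu>) powr (-B - 1)) \<longlongrightarrow>
      - (1 / B) * 0 + 1 / (B + 1) * 0) at_top"
      using assms by (intro tendsto_add tendsto_mult tendsto_const tendsto_one_plus_powr_at_top) auto
  qed (use assms in auto)
  also have "(- (1 / B) * 0 + 1 / (B + 1) * 0) - (- (1 / B) * 1 + 1 / (B + 1) * 1) = 1 / (B * (B + 1))"
    using assms by (simp add: divide_simps)
  finally show "(\<integral>\<^sup>+s. ennreal (indicator {0<..} s * (\<nu> * s powr (2 * \<nu> - 1) * (1 + s powr \<nu>) powr (-B - 2))) \<partial>lborel) =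
        ennreal (1 / (B * (B + 1)))" .
qed

lemma nn_integral_power_exp:
  assumes "0 < (W::real)"
  shows "(\<integral>\<^sup>+s. ennreal (indicator {0<..} s * s ^ m / fact m * exp (- (W * s))) \<partial>lborel) = ennreal (1 / W ^ Suc m)"
proof -
  have "(\<integral>\<^sup>+s. ennreal (indicator {0<..} s * s ^ m / fact m * exp (- (W * s))) \<partial>lborel) =
    (\<integral>\<^sup>+s. ennreal (1 / fact m) * ennreal (indicator {0<..} s * s powr (real (Suc m) - 1) * exp (- (W * s))) \<partial>lborel)"
    by (intro nn_integral_cong) (auto simp: indicator_def powr_realpow ennreal_mult[symmetric])
  also have "\<dots> = ennreal (1 / fact m) * ennreal (Gamma (real (Suc m)) / W powr real (Suc m))"
  proof (subst nn_integral_cmult)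
    have "(\<integral>\<^sup>+s. ennreal (indicator {0<..} s * s powr (real (Suc m) - 1) * exp (- (W * s))) \<partial>lborel) =
      ennreal (Gamma (real (Suc m)) / W powr real (Suc m))"
      using assms by (intro nn_integral_powr_exp) auto
    then show "ennreal (1 / fact m) * (\<integral>\<^sup>+s. ennreal (indicator {0<..} s * s powr (real (Suc m) - 1) * exp (- (W * s))) \<partial>lborel) =
      ennreal (1 / fact m) * ennreal (Gamma (real (Suc m)) / W powr real (Suc m))" by simp
  qed auto
  also have "\<dots> = ennreal (1 / W ^ Suc m)"
    using assms powr_realpow[OF assms, of "Suc m"] Gamma_fact[of m, where ?'a = real]
    by (simp add: ennreal_mult[symmetric] add.commute del: power_Suc)
  finally show ?thesis .
qed

subsection \<open>Change of variables on the simplex\<close>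

interpretation lborel_PiM: product_sigma_finite "\<lambda>_::nat. lborel :: real measure" ..

text \<open>Peel off one coordinate at a time and use the one-dimensional affine substitution, each
  contributing a factor \<open>y\<close>. The restriction keeps the scaled point
  extensional.\<close>

lemma nn_integral_PiM_lborel_scale:
  fixes I :: "nat set" and y :: real
  assumes "finite I" "0 < y" "h \<in> borel_measurable (Pi\<^sub>M I (\<lambda>_. lborel))"
  shows "(\<integral>\<^sup>+z. h z \<partial>Pi\<^sub>M I (\<lambda>_. lborel)) = ennreal (y ^ card I) * (\<integral>\<^sup>+q. h (\<lambda>i\<in>I. y * q i) \<partial>Pi\<^sub>M I (\<lambda>_. lborel))"
  using assms(1,3)
proof (induction I arbitrary: h)
  case empty
  then show ?case by (simp add: PiM_empty nn_integral_count_space_finite)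
next
  case (insert i I)
  note [measurable] = insert.prems
  have [measurable]: "(\<lambda>q. \<lambda>j\<in>I. y * q j) \<in> Pi\<^sub>M I (\<lambda>_. lborel) \<rightarrow>\<^sub>M Pi\<^sub>M I (\<lambda>_. lborel)"
    by measurable
  have [measurable]: "(\<lambda>q. \<lambda>j\<in>insert i I. y * q j) \<in> Pi\<^sub>M (insert i I) (\<lambda>_. lborel) \<rightarrow>\<^sub>M Pi\<^sub>M (insert i I) (\<lambda>_. lborel)"
    by measurable
  interpret I: sigma_finite_measure "Pi\<^sub>M I (\<lambda>_. lborel :: real measure)"
    by (rule lborel_PiM.sigma_finite) fact
  have upd[measurable]: "(\<lambda>(x, q). q(i := x)) \<in> lborel \<Otimes>\<^sub>M Pi\<^sub>M I (\<lambda>_. lborel) \<rightarrow>\<^sub>M Pi\<^sub>M (insert i I) (\<lambda>_. lborel :: real measure)"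
    unfolding case_prod_beta by measurable
  have hm: "(\<lambda>q. h (q(i := x))) \<in> borel_measurable (Pi\<^sub>M I (\<lambda>_. lborel))" for x
    by measurable
  have "(\<integral>\<^sup>+z. h z \<partial>Pi\<^sub>M (insert i I) (\<lambda>_. lborel)) = (\<integral>\<^sup>+x. (\<integral>\<^sup>+q. h (q(i := x)) \<partial>Pi\<^sub>M I (\<lambda>_. lborel)) \<partial>lborel)"
    using insert by (intro lborel_PiM.product_nn_integral_insert_rev) auto
  also have "\<dots> = (\<integral>\<^sup>+x. ennreal (y ^ card I) * (\<integral>\<^sup>+q. h ((\<lambda>j\<in>I. y * q j)(i := x)) \<partial>Pi\<^sub>M I (\<lambda>_. lborel)) \<partial>lborel)"
    by (intro nn_integral_cong insert.IH[OF hm])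
  also have "\<dots> = ennreal y * (\<integral>\<^sup>+x. ennreal (y ^ card I) * (\<integral>\<^sup>+q. h ((\<lambda>j\<in>I. y * q j)(i := y * x)) \<partial>Pi\<^sub>M I (\<lambda>_. lborel)) \<partial>lborel)"
    using \<open>0 < y\<close> by (subst nn_integral_real_affine[where c = y and t = 0]) auto
  also have "\<dots> = ennreal y * (ennreal (y ^ card I) * (\<integral>\<^sup>+x. (\<integral>\<^sup>+q. h ((\<lambda>j\<in>I. y * q j)(i := y * x)) \<partial>Pi\<^sub>M I (\<lambda>_. lborel)) \<partial>lborel))"
    by (subst nn_integral_cmult) auto
  also have "\<dots> = ennreal (y ^ card (insert i I)) * (\<integral>\<^sup>+x. (\<integral>\<^sup>+q. h ((\<lambda>j\<in>I. y * q j)(i := y * x)) \<partial>Pi\<^sub>M I (\<lambda>_. lborel)) \<partial>lborel)"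
    using insert.hyps \<open>0 < y\<close> by (simp add: mult.assoc[symmetric] ennreal_mult[symmetric])
  also have "(\<integral>\<^sup>+x. (\<integral>\<^sup>+q. h ((\<lambda>j\<in>I. y * q j)(i := y * x)) \<partial>Pi\<^sub>M I (\<lambda>_. lborel)) \<partial>lborel) =
    (\<integral>\<^sup>+x. (\<integral>\<^sup>+q. h (\<lambda>j\<in>insert i I. y * (q(i := x)) j) \<partial>Pi\<^sub>M I (\<lambda>_. lborel)) \<partial>lborel)"
    using insert.hyps by (intro nn_integral_cong arg_cong[where f = h]) (auto simp: fun_eq_iff)
  also have "(\<integral>\<^sup>+x. (\<integral>\<^sup>+q. h (\<lambda>j\<in>insert i I. y * (q(i := x)) j) \<partial>Pi\<^sub>M I (\<lambda>_. lborel)) \<partial>lborel) =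
    (\<integral>\<^sup>+q. h (\<lambda>j\<in>insert i I. y * q j) \<partial>Pi\<^sub>M (insert i I) (\<lambda>_. lborel))"
    using insert by (intro lborel_PiM.product_nn_integral_insert_rev[symmetric]) auto
  finally show ?case .
qed

text \<open>The substitution is split into a scaling of \<open>q\<close> for fixed \<open>y\<close>,
  with Jacobian y^|I|, and a shift of \<open>y\<close> for fixed \<open>z\<close>, with Fubini
  before and after the scaling. The vanishing of \<open>G\<close> and \<open>H\<close> on
  nonpositive arguments encodes the simplex.\<close>

lemma nn_integral_simplex_change_of_variables:
  fixes I :: "nat set" and G :: "nat \<Rightarrow> real \<Rightarrow> ennreal" and H :: "real \<Rightarrow> ennreal"
  assumes I: "finite I" "j \<in> I"
    and [measurable]: "\<And>i. G i \<in> borel_measurable borel" "H \<in> borel_measurable borel"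
    and G0: "\<And>i x. x \<le> 0 \<Longrightarrow> G i x = 0" and H0: "\<And>x. x \<le> 0 \<Longrightarrow> H x = 0"
  shows "(\<integral>\<^sup>+q. ennreal (q j ^ k) * (\<integral>\<^sup>+y. ennreal (indicator {0<..} y * y ^ card I) *
            ((\<Prod>i\<in>I. G i (y * q i)) * H (y - y * (\<Sum>i\<in>I. q i))) \<partial>lborel) \<partial>Pi\<^sub>M I (\<lambda>_. lborel)) =
         (\<integral>\<^sup>+z. (\<integral>\<^sup>+x. ennreal ((z j / (x + (\<Sum>i\<in>I. z i))) ^ k) * ((\<Prod>i\<in>I. G i (z i)) * H x) \<partial>lborel) \<partial>Pi\<^sub>M I (\<lambda>_. lborel))"
proof -
  interpret P: sigma_finite_measure "Pi\<^sub>M I (\<lambda>_. lborel :: real measure)"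
    by (rule lborel_PiM.sigma_finite) fact
  interpret PL: pair_sigma_finite "Pi\<^sub>M I (\<lambda>_. lborel :: real measure)" "lborel :: real measure" ..
  have [measurable]: "(\<lambda>q. q i) \<in> borel_measurable (Pi\<^sub>M I (\<lambda>_. lborel :: real measure))" if "i \<in> I" for i
    using measurable_component_singleton[OF that, of "\<lambda>_. lborel :: real measure"] by simp
  note [measurable] = this[OF I(2)]
  have [measurable]: "(\<lambda>p. fst p i) \<in> borel_measurable (Pi\<^sub>M I (\<lambda>_. lborel :: real measure) \<Otimes>\<^sub>M (lborel :: real measure))" if "i \<in> I" for i
    using measurable_compose[OF measurable_fst measurable_component_singleton[OF that, of "\<lambda>_. lborel :: real measure"]] by simp
  note [measurable] = this[OF I(2)]
  have "(\<integral>\<^sup>+q. ennreal (q j ^ k) * (\<integral>\<^sup>+y. ennreal (indicator {0<..} y * y ^ card I) *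
            ((\<Prod>i\<in>I. G i (y * q i)) * H (y - y * (\<Sum>i\<in>I. q i))) \<partial>lborel) \<partial>Pi\<^sub>M I (\<lambda>_. lborel)) =
        (\<integral>\<^sup>+q. (\<integral>\<^sup>+y. ennreal (q j ^ k) * (ennreal (indicator {0<..} y * y ^ card I) *
            ((\<Prod>i\<in>I. G i (y * q i)) * H (y - y * (\<Sum>i\<in>I. q i)))) \<partial>lborel) \<partial>Pi\<^sub>M I (\<lambda>_. lborel))"
    by (rule nn_integral_cong, rule nn_integral_cmult[symmetric]) simp
  also have "\<dots> = (\<integral>\<^sup>+y. (\<integral>\<^sup>+q. ennreal (q j ^ k) * (ennreal (indicator {0<..} y * y ^ card I) *
            ((\<Prod>i\<in>I. G i (y * q i)) * H (y - y * (\<Sum>i\<in>I. q i)))) \<partial>Pi\<^sub>M I (\<lambda>_. lborel)) \<partial>lborel)"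
    by (rule PL.Fubini'[symmetric]) (simp add: case_prod_beta, measurable)
  also have "\<dots> = (\<integral>\<^sup>+y. (\<integral>\<^sup>+z. indicator {0<..} y * (ennreal ((z j / y) ^ k) *
            ((\<Prod>i\<in>I. G i (z i)) * H (y - (\<Sum>i\<in>I. z i)))) \<partial>Pi\<^sub>M I (\<lambda>_. lborel)) \<partial>lborel)"
  proof (rule nn_integral_cong)
    fix y :: real
    show "(\<integral>\<^sup>+q. ennreal (q j ^ k) * (ennreal (indicator {0<..} y * y ^ card I) *
            ((\<Prod>i\<in>I. G i (y * q i)) * H (y - y * (\<Sum>i\<in>I. q i)))) \<partial>Pi\<^sub>M I (\<lambda>_. lborel)) =
      (\<integral>\<^sup>+z. indicator {0<..} y * (ennreal ((z j / y) ^ k) *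
            ((\<Prod>i\<in>I. G i (z i)) * H (y - (\<Sum>i\<in>I. z i)))) \<partial>Pi\<^sub>M I (\<lambda>_. lborel))"
    proof (cases "0 < y")
      case True
      define h where "h z = ennreal ((z j / y) ^ k) * ((\<Prod>i\<in>I. G i (z i)) * H (y - (\<Sum>i\<in>I. z i)))" for z :: "nat \<Rightarrow> real"
      have [measurable]: "h \<in> borel_measurable (Pi\<^sub>M I (\<lambda>_. lborel))" unfolding h_def by measurable
      have hy: "h (\<lambda>i\<in>I. y * q i) = ennreal (q j ^ k) * ((\<Prod>i\<in>I. G i (y * q i)) * H (y - y * (\<Sum>i\<in>I. q i)))" for q
        using True I(2) by (simp add: h_def sum_distrib_left)
      have "(\<integral>\<^sup>+q. ennreal (q j ^ k) * (ennreal (indicator {0<..} y * y ^ card I) *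
            ((\<Prod>i\<in>I. G i (y * q i)) * H (y - y * (\<Sum>i\<in>I. q i)))) \<partial>Pi\<^sub>M I (\<lambda>_. lborel)) =
          (\<integral>\<^sup>+q. ennreal (y ^ card I) * h (\<lambda>i\<in>I. y * q i) \<partial>Pi\<^sub>M I (\<lambda>_. lborel))"
        unfolding hy using True by (simp add: mult_ac)
      also have "\<dots> = ennreal (y ^ card I) * (\<integral>\<^sup>+q. h (\<lambda>i\<in>I. y * q i) \<partial>Pi\<^sub>M I (\<lambda>_. lborel))"
        by (rule nn_integral_cmult) measurable
      also have "\<dots> = (\<integral>\<^sup>+z. h z \<partial>Pi\<^sub>M I (\<lambda>_. lborel))"
        using True I by (intro nn_integral_PiM_lborel_scale[symmetric]) auto
      finally show ?thesis using True by (simp add: h_def)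
    qed simp
  qed
  also have "\<dots> = (\<integral>\<^sup>+z. (\<integral>\<^sup>+y. indicator {0<..} y * (ennreal ((z j / y) ^ k) *
            ((\<Prod>i\<in>I. G i (z i)) * H (y - (\<Sum>i\<in>I. z i)))) \<partial>lborel) \<partial>Pi\<^sub>M I (\<lambda>_. lborel))"
    by (rule PL.Fubini') (simp add: case_prod_beta, measurable)
  also have "\<dots> = (\<integral>\<^sup>+z. (\<integral>\<^sup>+x. ennreal ((z j / (x + (\<Sum>i\<in>I. z i))) ^ k) * ((\<Prod>i\<in>I. G i (z i)) * H x) \<partial>lborel) \<partial>Pi\<^sub>M I (\<lambda>_. lborel))"
  proof (rule nn_integral_cong)
    fix z :: "nat \<Rightarrow> real"
    have "(\<integral>\<^sup>+y. indicator {0<..} y * (ennreal ((z j / y) ^ k) * ((\<Prod>i\<in>I. G i (z i)) * H (y - (\<Sum>i\<in>I. z i)))) \<partial>lborel) =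
      (\<integral>\<^sup>+x. indicator {0<..} ((\<Sum>i\<in>I. z i) + 1 * x) * (ennreal ((z j / ((\<Sum>i\<in>I. z i) + 1 * x)) ^ k) *
        ((\<Prod>i\<in>I. G i (z i)) * H ((\<Sum>i\<in>I. z i) + 1 * x - (\<Sum>i\<in>I. z i)))) \<partial>lborel)"
      by (subst nn_integral_real_affine[where c = 1 and t = "\<Sum>i\<in>I. z i"]) auto
    also have "\<dots> = (\<integral>\<^sup>+x. ennreal ((z j / (x + (\<Sum>i\<in>I. z i))) ^ k) * ((\<Prod>i\<in>I. G i (z i)) * H x) \<partial>lborel)"
    proof (rule nn_integral_cong)
      fix x :: real
      show "indicator {0<..} ((\<Sum>i\<in>I. z i) + 1 * x) * (ennreal ((z j / ((\<Sum>i\<in>I. z i) + 1 * x)) ^ k) *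
        ((\<Prod>i\<in>I. G i (z i)) * H ((\<Sum>i\<in>I. z i) + 1 * x - (\<Sum>i\<in>I. z i)))) =
        ennreal ((z j / (x + (\<Sum>i\<in>I. z i))) ^ k) * ((\<Prod>i\<in>I. G i (z i)) * H x)"
      \<comment> \<open>If all variables are positive then so is the total, and the indicator equals
        1. Otherwise the product of \<open>G\<close> and \<open>H\<close> kills both sides.\<close>
      proof (cases "0 < x \<and> (\<forall>i\<in>I. 0 < z i)")
        case True
        then have "0 \<le> (\<Sum>i\<in>I. z i)" by (intro sum_nonneg) auto
        then have "0 < (\<Sum>i\<in>I. z i) + x" using True by simp
        then show ?thesis by (simp add: add.commute)
      next
        case False
        then have "(\<Prod>i\<in>I. G i (z i)) * H x = 0"
          using G0 H0 I(1) by (metis linorder_not_less mult_eq_0_iff prod_zero)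
        moreover have "(\<Sum>i\<in>I. z i) + 1 * x - (\<Sum>i\<in>I. z i) = x" by simp
        ultimately show ?thesis by (simp only: mult_zero_right)
      qed
    qed
    finally show "(\<integral>\<^sup>+y. indicator {0<..} y * (ennreal ((z j / y) ^ k) * ((\<Prod>i\<in>I. G i (z i)) * H (y - (\<Sum>i\<in>I. z i)))) \<partial>lborel) =
      (\<integral>\<^sup>+x. ennreal ((z j / (x + (\<Sum>i\<in>I. z i))) ^ k) * ((\<Prod>i\<in>I. G i (z i)) * H x) \<partial>lborel)" .
  qed
  finally show ?thesis .
qed

text \<open>The kernel s^m / m! represents the power W^-(m+1), hence the exponent
  \<open>Suc m\<close>. The numerator is attached to the j-th coordinate, so the integrand is a
  product over coordinates; since it is \<open>ennreal\<close>-valued, Tonelli needs no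
  integrability.\<close>

lemma nn_integral_ratio_power:
  fixes I :: "nat set" and G :: "nat \<Rightarrow> real \<Rightarrow> ennreal" and H :: "real \<Rightarrow> ennreal"
  assumes I: "finite I" "j \<in> I"
    and [measurable]: "\<And>i. G i \<in> borel_measurable borel" "H \<in> borel_measurable borel"
    and G0: "\<And>i x. x \<le> 0 \<Longrightarrow> G i x = 0" and H0: "\<And>x. x \<le> 0 \<Longrightarrow> H x = 0"
  shows "(\<integral>\<^sup>+z. (\<integral>\<^sup>+x. ennreal ((z j / (x + (\<Sum>i\<in>I. z i))) ^ Suc m) * ((\<Prod>i\<in>I. G i (z i)) * H x) \<partial>lborel) \<partial>Pi\<^sub>M I (\<lambda>_. lborel)) =
    (\<integral>\<^sup>+s. ennreal (indicator {0<..} s * s ^ m / fact m) *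
      ((\<Prod>i\<in>I. \<integral>\<^sup>+x. ennreal (if i = j then x ^ Suc m else 1) * ennreal (exp (- (s * x))) * G i x \<partial>lborel) *
       (\<integral>\<^sup>+x. ennreal (exp (- (s * x))) * H x \<partial>lborel)) \<partial>lborel)"
proof -
  interpret P: sigma_finite_measure "Pi\<^sub>M I (\<lambda>_. lborel :: real measure)"
    by (rule lborel_PiM.sigma_finite) fact
  interpret PL: pair_sigma_finite "Pi\<^sub>M I (\<lambda>_. lborel :: real measure)" "lborel :: real measure" ..
  have [measurable]: "(\<lambda>q. q i) \<in> borel_measurable (Pi\<^sub>M I (\<lambda>_. lborel :: real measure))" if "i \<in> I" for i
    using measurable_component_singleton[OF that, of "\<lambda>_. lborel :: real measure"] by simp
  have [measurable]: "(\<lambda>p. fst p i) \<in> borel_measurable (Pi\<^sub>M I (\<lambda>_. lborel :: real measure) \<Otimes>\<^sub>M (lborel :: real measure))" if "i \<in> I" for i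
    using measurable_compose[OF measurable_fst measurable_component_singleton[OF that, of "\<lambda>_. lborel :: real measure"]] by simp
  define e where "e s = ennreal (indicator {0<..} s * s ^ m / fact m)" for s :: real
  define g where "g s i x = ennreal (if i = j then x ^ Suc m else 1) * ennreal (exp (- (s * x))) * G i x" for s i x
  define E where "E s = (\<integral>\<^sup>+x. ennreal (exp (- (s * x))) * H x \<partial>lborel)" for s
  have [measurable]: "e \<in> borel_measurable borel" unfolding e_def by measurable
  have [measurable]: "case_prod (\<lambda>s x. g s i x) \<in> borel_measurable (borel \<Otimes>\<^sub>M borel)" for i
    unfolding g_def by measurable
  have g_meas[measurable (raw)]: "(\<lambda>w. g (f w) i (f' w)) \<in> borel_measurable N"
    if [measurable]: "f \<in> borel_measurable N" "f' \<in> borel_measurable N" for f f' i N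
    unfolding g_def by measurable
  have [measurable]: "E \<in> borel_measurable borel" unfolding E_def by measurable
  have pt: "ennreal ((z j / (x + (\<Sum>i\<in>I. z i))) ^ Suc m) * ((\<Prod>i\<in>I. G i (z i)) * H x) =
    (\<integral>\<^sup>+s. e s * ((\<Prod>i\<in>I. g s i (z i)) * (ennreal (exp (- (s * x))) * H x)) \<partial>lborel)" for z x
  proof (cases "0 < x \<and> (\<forall>i\<in>I. 0 < z i)")
    case True
    define W where "W = x + (\<Sum>i\<in>I. z i)"
    have "0 \<le> (\<Sum>i\<in>I. z i)" using True by (intro sum_nonneg) auto
    then have W: "0 < W" using True by (simp add: W_def)
    have zj: "0 < z j" using True I by auto
    have prod: "(\<Prod>i\<in>I. g s i (z i)) * (ennreal (exp (- (s * x))) * H x) =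
      ennreal (exp (- (W * s))) * (ennreal (z j ^ Suc m) * ((\<Prod>i\<in>I. G i (z i)) * H x))" for s
    proof -
      have "(\<Prod>i\<in>I. ennreal (if i = j then z i ^ Suc m else 1)) = ennreal (z j ^ Suc m)"
        using I by (simp add: if_distrib[of ennreal] prod.delta cong: if_cong)
      moreover have "(\<Prod>i\<in>I. ennreal (exp (- (s * z i)))) * ennreal (exp (- (s * x))) = ennreal (exp (- (W * s)))"
        using I by (simp add: prod_ennreal exp_sum[symmetric] ennreal_mult[symmetric] exp_add[symmetric] W_def sum_negf
            sum_distrib_left algebra_simps)
      moreover have "P1 * P2 * P3 * (u * v) = (P2 * u) * (P1 * (P3 * v))" for P1 P2 P3 u v :: ennreal
        by (simp only: mult_ac)
      ultimately show ?thesis unfolding g_def prod.distrib by (simp only:)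
    qed
    have "(\<integral>\<^sup>+s. e s * ((\<Prod>i\<in>I. g s i (z i)) * (ennreal (exp (- (s * x))) * H x)) \<partial>lborel) =
      (\<integral>\<^sup>+s. ennreal (indicator {0<..} s * s ^ m / fact m * exp (- (W * s))) * (ennreal (z j ^ Suc m) * ((\<Prod>i\<in>I. G i (z i)) * H x)) \<partial>lborel)"
      unfolding prod e_def
      by (intro nn_integral_cong) (simp add: indicator_def ennreal_mult[symmetric] mult.assoc[symmetric])
    also have "\<dots> = ennreal (1 / W ^ Suc m) * (ennreal (z j ^ Suc m) * ((\<Prod>i\<in>I. G i (z i)) * H x))"
      by (subst nn_integral_multc, simp) (simp only: nn_integral_power_exp[OF W])
    also have "\<dots> = ennreal ((z j / W) ^ Suc m) * ((\<Prod>i\<in>I. G i (z i)) * H x)"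
      using W zj by (simp add: mult.assoc[symmetric] ennreal_mult[symmetric] power_divide del: power_Suc)
    finally show ?thesis by (simp add: W_def)
  next
    case False
    then consider i where "i \<in> I" "z i \<le> 0" | "x \<le> 0" by force
    then have "(\<Prod>i\<in>I. G i (z i)) * H x = 0 \<and>
      (\<forall>s. (\<Prod>i\<in>I. g s i (z i)) * (ennreal (exp (- (s * x))) * H x) = 0)"
    proof cases
      case 1
      have "(\<Prod>i\<in>I. G i (z i)) = 0" "(\<Prod>i\<in>I. g s i (z i)) = 0" for s
        using G0[OF 1(2)] by (auto intro!: prod_zero bexI[OF _ 1(1)] I(1) simp: g_def)
      then show ?thesis by (simp only: mult_zero_left) simp
    qed (simp add: H0)
    then show ?thesis by (simp only: mult_zero_right nn_integral_const) simp
  qed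
  have "(\<integral>\<^sup>+z. (\<integral>\<^sup>+x. ennreal ((z j / (x + (\<Sum>i\<in>I. z i))) ^ Suc m) * ((\<Prod>i\<in>I. G i (z i)) * H x) \<partial>lborel) \<partial>Pi\<^sub>M I (\<lambda>_. lborel)) =
    (\<integral>\<^sup>+z. (\<integral>\<^sup>+s. (\<integral>\<^sup>+x. e s * ((\<Prod>i\<in>I. g s i (z i)) * (ennreal (exp (- (s * x))) * H x)) \<partial>lborel) \<partial>lborel) \<partial>Pi\<^sub>M I (\<lambda>_. lborel))"
    unfolding pt by (intro nn_integral_cong lborel_pair.Fubini') measurable
  also have "\<dots> = (\<integral>\<^sup>+z. (\<integral>\<^sup>+s. e s * ((\<Prod>i\<in>I. g s i (z i)) * E s) \<partial>lborel) \<partial>Pi\<^sub>M I (\<lambda>_. lborel))"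
    unfolding E_def by (intro nn_integral_cong) (simp add: nn_integral_cmult)
  also have "\<dots> = (\<integral>\<^sup>+s. (\<integral>\<^sup>+z. e s * ((\<Prod>i\<in>I. g s i (z i)) * E s) \<partial>Pi\<^sub>M I (\<lambda>_. lborel)) \<partial>lborel)"
    by (rule PL.Fubini'[symmetric]) (simp add: case_prod_beta, measurable)
  also have "\<dots> = (\<integral>\<^sup>+s. e s * ((\<Prod>i\<in>I. \<integral>\<^sup>+x. g s i x \<partial>lborel) * E s) \<partial>lborel)"
  proof (rule nn_integral_cong)
    fix s
    have "(\<integral>\<^sup>+z. e s * ((\<Prod>i\<in>I. g s i (z i)) * E s) \<partial>Pi\<^sub>M I (\<lambda>_. lborel)) =
      e s * ((\<integral>\<^sup>+z. (\<Prod>i\<in>I. g s i (z i)) \<partial>Pi\<^sub>M I (\<lambda>_. lborel)) * E s)"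
      by (simp add: nn_integral_cmult nn_integral_multc)
    then show "(\<integral>\<^sup>+z. e s * ((\<Prod>i\<in>I. g s i (z i)) * E s) \<partial>Pi\<^sub>M I (\<lambda>_. lborel)) =
      e s * ((\<Prod>i\<in>I. \<integral>\<^sup>+x. g s i x \<partial>lborel) * E s)"
      using I by (simp add: lborel_PiM.product_nn_integral_prod)
  qed
  finally show ?thesis unfolding e_def g_def E_def .
qed

subsection \<open>Moments of the fractional Dirichlet distribution\<close>

locale fractional_dirichlet =
  fixes \<nu> :: real and n :: nat and \<beta> :: "nat \<Rightarrow> real"
  assumes n: "2 \<le> n" and nu: "0 < \<nu>" "\<nu> \<le> 1" and beta: "\<And>i. i \<in> {1..n} \<Longrightarrow> 0 < \<beta> i"
begin

lemma fg: "i \<in> {1..n} \<Longrightarrow> fractional_gamma \<nu> (\<beta> i)"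
  using nu beta by (simp add: fractional_gamma_def)

abbreviation "g i \<equiv> fg_density \<nu> (\<beta> i)"

text \<open>The coercion loses nothing on \<open>{1..n}\<close>, where the densities have been shown
  nonnegative.\<close>

definition G :: "nat \<Rightarrow> real \<Rightarrow> ennreal" where
  "G i x = (if i \<in> {1..n} then ennreal (g i x) else 0)"

text \<open>The density of the ratio vector (Z_1/W, ..., Z_(n-1)/W) as a possibly infinite integral;
  y^(n-1) is the Jacobian, and the powers of the \<open>q i\<close> are absorbed into the
  factors.\<close>

definition inner :: "(nat \<Rightarrow> real) \<Rightarrow> ennreal" where
  "inner q = (\<integral>\<^sup>+y. ennreal (indicator {0<..} y * y ^ card {1..<n}) *
     ((\<Prod>i=1..<n. G i (y * q i)) * G n (y - y * (\<Sum>i=1..<n. q i))) \<partial>lborel)"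

lemma G_measurable [measurable]: "G i \<in> borel_measurable borel"
  unfolding G_def by measurable

lemma G_zero: "x \<le> 0 \<Longrightarrow> G i x = 0"
  by (simp add: G_def fg_density_def)

lemma sum_beta_eq: "(\<Sum>i=1..n. \<beta> i) = (\<Sum>i=1..<n. \<beta> i) + \<beta> n"
  using n by (cases n) (simp_all add: atLeastLessThanSuc_atLeastAtMost)

lemma sum_beta_pos: "0 < (\<Sum>i=1..n. \<beta> i)"
  using n beta by (intro sum_pos) auto

lemma density_outside_simplex:
  assumes "\<not> ((\<forall>i\<in>{1..<n}. 0 < q i) \<and> (\<Sum>i=1..<n. q i) < 1)"
  shows "inner q = 0" "fractional_dirichlet_density \<nu> n \<beta> q = 0"
proof -
  have "ennreal (indicator {0<..} y * y ^ card {1..<n}) *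
     ((\<Prod>i=1..<n. G i (y * q i)) * G n (y - y * (\<Sum>i=1..<n. q i))) = 0" for y
  proof (cases "0 < y")
    case y: True
    consider i where "i \<in> {1..<n}" "q i \<le> 0" | "1 \<le> (\<Sum>i=1..<n. q i)" using assms by force
    then show ?thesis
    proof cases
      case 1
      then have "G i (y * q i) = 0" using y by (intro G_zero) (simp add: mult_le_0_iff)
      then have "(\<Prod>i=1..<n. G i (y * q i)) = 0" using 1 by (intro prod_zero) auto
      then show ?thesis by simp
    next
      case 2
      then have "G n (y - y * (\<Sum>i=1..<n. q i)) = 0" using y by (intro G_zero) simp
      then show ?thesis by simp
    qed
  qed simp
  then show "inner q = 0" by (simp only: inner_def nn_integral_const mult_zero_left)
  show "fractional_dirichlet_density \<nu> n \<beta> q = 0" using assms by (auto simp: fractional_dirichlet_density_def)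
qed

text \<open>The exponents balance: the n - 1 of the Jacobian and the n exponents \<nu>\<beta>_i - 1
  add up to \<nu>B - 1, the power of \<open>y\<close> in the definition, while the powers of the
  \<open>q i\<close> and of 1 - S form \<open>C\<close>.\<close>

lemma density_inside_simplex:
  assumes q: "\<forall>i\<in>{1..<n}. 0 < q i" "(\<Sum>i=1..<n. q i) < 1"
  shows "0 \<le> fractional_dirichlet_density \<nu> n \<beta> q"
    and "inner q \<noteq> \<infinity> \<Longrightarrow> ennreal (fractional_dirichlet_density \<nu> n \<beta> q) = inner q"
proof -
  define S where "S = (\<Sum>i=1..<n. q i)"
  define B where "B = (\<Sum>i=1..n. \<beta> i)"
  define C where "C = (\<Prod>i=1..<n. q i powr (\<nu> * \<beta> i - 1)) * (1 - S) powr (\<nu> * \<beta> n - 1)"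
  define L where "L y = indicator {0<..} y * (y powr (\<nu> * B - 1) *
              (\<Prod>i=1..<n. mittag_leffler \<nu> (\<nu> * \<beta> i) (\<beta> i) (- ((y * q i) powr \<nu>))) *
              mittag_leffler \<nu> (\<nu> * \<beta> n) (\<beta> n) (- ((y - y * S) powr \<nu>)))" for y
  have f: "fractional_dirichlet_density \<nu> n \<beta> q = C * (\<integral>y. L y \<partial>lborel)"
    using q unfolding fractional_dirichlet_density_def C_def S_def L_def B_def set_lebesgue_integral_def by simp
  have C: "0 < C" using q by (auto simp: C_def S_def intro!: mult_pos_pos prod_pos)
  have CL: "C * L y = indicator {0<..} y * y ^ card {1..<n} * ((\<Prod>i=1..<n. g i (y * q i)) * g n (y - y * S))" for y
  proof (cases "0 < y")
    case True
    have e: "y - y * S = y * (1 - S)" by (simp add: right_diff_distrib)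
    have 1: "g i (y * q i) = y powr (\<nu> * \<beta> i - 1) * (q i powr (\<nu> * \<beta> i - 1) * mittag_leffler \<nu> (\<nu> * \<beta> i) (\<beta> i) (- ((y * q i) powr \<nu>)))"
      if "i \<in> {1..<n}" for i
      using True q that by (simp add: fg_density_def powr_mult)
    have 2: "g n (y - y * S) = y powr (\<nu> * \<beta> n - 1) * ((1 - S) powr (\<nu> * \<beta> n - 1) * mittag_leffler \<nu> (\<nu> * \<beta> n) (\<beta> n) (- ((y - y * S) powr \<nu>)))"
      unfolding e using True q by (simp add: fg_density_def powr_mult S_def)
    have "y powr (\<nu> * B - 1) = y ^ card {1..<n} * ((\<Prod>i=1..<n. y powr (\<nu> * \<beta> i - 1)) * y powr (\<nu> * \<beta> n - 1))"
    proof -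
      have "\<nu> * B - 1 = real (card {1..<n}) + ((\<Sum>i=1..<n. \<nu> * \<beta> i - 1) + (\<nu> * \<beta> n - 1))"
        unfolding B_def sum_beta_eq using n by (simp add: sum_subtractf sum_distrib_left distrib_left of_nat_diff)
      moreover have "y powr (\<Sum>i=1..<n. \<nu> * \<beta> i - 1) = (\<Prod>i=1..<n. y powr (\<nu> * \<beta> i - 1))"
        using True by (intro powr_sum) auto
      ultimately show ?thesis
        using powr_realpow[OF True, of "card {1..<n}"] by (simp only: powr_add)
    qed
    moreover have "(\<Prod>i=1..<n. g i (y * q i)) = (\<Prod>i=1..<n. y powr (\<nu> * \<beta> i - 1) *
        (q i powr (\<nu> * \<beta> i - 1) * mittag_leffler \<nu> (\<nu> * \<beta> i) (\<beta> i) (- ((y * q i) powr \<nu>))))"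
      by (intro prod.cong 1) auto
    ultimately show ?thesis
      unfolding L_def C_def 2 using True by (simp add: prod.distrib)
  qed (simp add: L_def)
  have gpos: "0 \<le> g i x" if "i \<in> {1..n}" for i x
    using fractional_gamma.fg_density_nonneg[OF fg[OF that]] .
  have CLpos: "0 \<le> C * L y" for y
  proof (cases "0 < y")
    case True
    then show ?thesis unfolding CL using n gpos by (intro mult_nonneg_nonneg prod_nonneg) auto
  qed (simp add: L_def)
  \<comment> \<open>The sign of the Mittag-Leffler product is obtained from the fractional Gamma
    densities after division by the positive prefactor \<open>C\<close>.\<close>
  then have Lpos: "0 \<le> L y" for y using C by (simp add: zero_le_mult_iff)
  have [measurable]: "L \<in> borel_measurable borel" unfolding L_def by measurable
  show "0 \<le> fractional_dirichlet_density \<nu> n \<beta> q"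
    unfolding f using C Lpos by (intro mult_nonneg_nonneg integral_nonneg_AE) auto
  have "inner q = (\<integral>\<^sup>+y. ennreal (C * L y) \<partial>lborel)"
    unfolding inner_def
  proof (rule nn_integral_cong)
    fix y
    have "(\<Prod>i=1..<n. G i (y * q i)) * G n (y - y * (\<Sum>i=1..<n. q i)) =
      ennreal ((\<Prod>i=1..<n. g i (y * q i)) * g n (y - y * S))"
    proof -
      have "(\<Prod>i=1..<n. G i (y * q i)) = (\<Prod>i=1..<n. ennreal (g i (y * q i)))"
        by (intro prod.cong) (auto simp: G_def)
      also have "\<dots> = ennreal (\<Prod>i=1..<n. g i (y * q i))"
        using gpos by (intro prod_ennreal) auto
      finally have "(\<Prod>i=1..<n. G i (y * q i)) = ennreal (\<Prod>i=1..<n. g i (y * q i))" .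
      moreover have "0 \<le> (\<Prod>i=1..<n. g i (y * q i))" "0 \<le> g n (y - y * S)"
        using n gpos by (auto intro!: prod_nonneg)
      ultimately show ?thesis
        using n by (simp add: G_def S_def ennreal_mult)
    qed
    moreover have "0 \<le> (\<Prod>i=1..<n. g i (y * q i)) * g n (y - y * S)"
      using n gpos by (intro mult_nonneg_nonneg prod_nonneg) auto
    ultimately show "ennreal (indicator {0<..} y * y ^ card {1..<n}) *
       ((\<Prod>i=1..<n. G i (y * q i)) * G n (y - y * (\<Sum>i=1..<n. q i))) = ennreal (C * L y)"
      unfolding CL by (cases "0 < y") (simp_all add: ennreal_mult)
  qed
  also have "\<dots> = ennreal C * (\<integral>\<^sup>+y. ennreal (L y) \<partial>lborel)"
    using C Lpos by (simp add: ennreal_mult nn_integral_cmult)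
  finally have inner: "inner q = ennreal C * (\<integral>\<^sup>+y. ennreal (L y) \<partial>lborel)" .
  assume "inner q \<noteq> \<infinity>"
  then have fin: "(\<integral>\<^sup>+y. ennreal (L y) \<partial>lborel) < \<infinity>"
    using C unfolding inner by (auto simp: ennreal_mult_eq_top_iff less_top[symmetric])
  have "integrable lborel L" using fin Lpos by (intro integrableI_nonneg) auto
  then have "(\<integral>\<^sup>+y. ennreal (L y) \<partial>lborel) = ennreal (\<integral>y. L y \<partial>lborel)"
    using Lpos by (intro nn_integral_eq_integral) auto
  then show "ennreal (fractional_dirichlet_density \<nu> n \<beta> q) = inner q"
    unfolding f inner using C Lpos by (simp add: ennreal_mult integral_nonneg_AE)
qed

lemma density_nonneg: "0 \<le> fractional_dirichlet_density \<nu> n \<beta> q"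
  using density_outside_simplex(2)[of q] density_inside_simplex(1)[of q] by fastforce

lemma component_measurable:
  "i \<in> {1..<n} \<Longrightarrow> (\<lambda>q. q i) \<in> borel_measurable (Pi\<^sub>M {1..<n} (\<lambda>_. lborel :: real measure))"
  using measurable_component_singleton[of i "{1..<n}" "\<lambda>_. lborel :: real measure"] by simp

lemma inner_measurable [measurable]: "inner \<in> borel_measurable (Pi\<^sub>M {1..<n} (\<lambda>_. lborel :: real measure))"
proof -
  have [measurable]: "(\<lambda>p. fst p i) \<in> borel_measurable (Pi\<^sub>M {1..<n} (\<lambda>_. lborel :: real measure) \<Otimes>\<^sub>M (lborel :: real measure))"
    if "i \<in> {1..<n}" for i
    using measurable_compose[OF measurable_fst component_measurable[OF that]] .
  show ?thesis
    unfolding inner_def by (rule lborel.borel_measurable_nn_integral) (simp add: case_prod_beta, measurable)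
qed

text \<open>Coordinate j contributes its moment and every other index i, including n, the factor (1
  + s^\<nu>)^-\<beta>_i. The exponents sum to \<beta>_j minus the total.\<close>

lemma nn_integral_power_inner:
  assumes j: "j \<in> {1..<n}"
  shows "(\<integral>\<^sup>+q. ennreal (q j ^ Suc m) * inner q \<partial>Pi\<^sub>M {1..<n} (\<lambda>_. lborel)) =
    (\<integral>\<^sup>+s. ennreal (indicator {0<..} s * (s ^ m / fact m * (fractional_gamma.moment \<nu> (\<beta> j) (Suc m) s *
      (1 + s powr \<nu>) powr (\<beta> j - (\<Sum>i=1..n. \<beta> i))))) \<partial>lborel)"
proof -
  let ?I = "{1..<n}"
  have "(\<integral>\<^sup>+q. ennreal (q j ^ Suc m) * inner q \<partial>Pi\<^sub>M ?I (\<lambda>_. lborel)) =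
    (\<integral>\<^sup>+z. (\<integral>\<^sup>+x. ennreal ((z j / (x + (\<Sum>i\<in>?I. z i))) ^ Suc m) * ((\<Prod>i\<in>?I. G i (z i)) * G n x) \<partial>lborel) \<partial>Pi\<^sub>M ?I (\<lambda>_. lborel))"
    unfolding inner_def using j by (intro nn_integral_simplex_change_of_variables G_measurable G_zero) auto
  also have "\<dots> = (\<integral>\<^sup>+s. ennreal (indicator {0<..} s * s ^ m / fact m) *
      ((\<Prod>i\<in>?I. \<integral>\<^sup>+x. ennreal (if i = j then x ^ Suc m else 1) * ennreal (exp (- (s * x))) * G i x \<partial>lborel) *
       (\<integral>\<^sup>+x. ennreal (exp (- (s * x))) * G n x \<partial>lborel)) \<partial>lborel)"
    using j by (intro nn_integral_ratio_power G_measurable G_zero) auto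
  also have "\<dots> = (\<integral>\<^sup>+s. ennreal (indicator {0<..} s * (s ^ m / fact m * (fractional_gamma.moment \<nu> (\<beta> j) (Suc m) s *
      (1 + s powr \<nu>) powr (\<beta> j - (\<Sum>i=1..n. \<beta> i))))) \<partial>lborel)"
  proof (rule nn_integral_cong)
    fix s :: real
    let ?Q = "1 + s powr \<nu>"
    define M where "M = fractional_gamma.moment \<nu> (\<beta> j) (Suc m) s"
    have M: "0 \<le> M" using fractional_gamma.moment_nonneg[OF fg] j by (simp add: M_def)
    show "ennreal (indicator {0<..} s * s ^ m / fact m) *
      ((\<Prod>i\<in>?I. \<integral>\<^sup>+x. ennreal (if i = j then x ^ Suc m else 1) * ennreal (exp (- (s * x))) * G i x \<partial>lborel) *
       (\<integral>\<^sup>+x. ennreal (exp (- (s * x))) * G n x \<partial>lborel)) =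
      ennreal (indicator {0<..} s * (s ^ m / fact m * (fractional_gamma.moment \<nu> (\<beta> j) (Suc m) s *
      ?Q powr (\<beta> j - (\<Sum>i=1..n. \<beta> i)))))"
    proof (cases "0 < s")
      case s: True
      have 0: "(\<integral>\<^sup>+x. ennreal (exp (- (s * x))) * G i x \<partial>lborel) = ennreal (?Q powr (- \<beta> i))"
        if "i \<in> {1..n}" for i
        using fractional_gamma.nn_integral_moment[OF fg[OF that] s, of 0]
          fractional_gamma.moment_0[OF fg[OF that] s] that
        by (simp add: G_def)
      have 1: "(\<integral>\<^sup>+x. ennreal (x ^ Suc m) * ennreal (exp (- (s * x))) * G j x \<partial>lborel) = ennreal M"
        using fractional_gamma.nn_integral_moment[OF fg s, of j "Suc m"] j by (simp add: G_def M_def)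
      have "(\<integral>\<^sup>+x. ennreal (if i = j then x ^ Suc m else 1) * ennreal (exp (- (s * x))) * G i x \<partial>lborel) =
        ennreal (if i = j then M else ?Q powr (- \<beta> i))" if "i \<in> ?I" for i
        using 0[of i] 1 that by (cases "i = j") (simp_all del: power_Suc)
      then have "(\<Prod>i\<in>?I. \<integral>\<^sup>+x. ennreal (if i = j then x ^ Suc m else 1) * ennreal (exp (- (s * x))) * G i x \<partial>lborel) =
        ennreal (\<Prod>i\<in>?I. if i = j then M else ?Q powr (- \<beta> i))"
        using M by (subst prod_ennreal[symmetric]) (auto intro!: prod.cong)
      also have "(\<Prod>i\<in>?I. if i = j then M else ?Q powr (- \<beta> i)) = M * (\<Prod>i\<in>?I - {j}. ?Q powr (- \<beta> i))"
        using j by (subst prod.remove[of _ j]) (auto intro!: prod.cong)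
      also have "(\<Prod>i\<in>?I - {j}. ?Q powr (- \<beta> i)) = ?Q powr (\<Sum>i\<in>?I - {j}. - \<beta> i)"
        using one_plus_powr_pos[of s \<nu>] by (subst powr_sum) auto
      also have "(\<Sum>i\<in>?I - {j}. - \<beta> i) = \<beta> j - (\<Sum>i\<in>?I. \<beta> i)"
        using j by (subst sum.remove[of ?I j]) (auto simp: sum_negf)
      finally have P: "(\<Prod>i\<in>?I. \<integral>\<^sup>+x. ennreal (if i = j then x ^ Suc m else 1) * ennreal (exp (- (s * x))) * G i x \<partial>lborel) =
        ennreal (M * ?Q powr (\<beta> j - (\<Sum>i\<in>?I. \<beta> i)))" .
      have "?Q powr (\<beta> j - (\<Sum>i\<in>?I. \<beta> i)) * ?Q powr (- \<beta> n) = ?Q powr (\<beta> j - (\<Sum>i=1..n. \<beta> i))"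
        unfolding sum_beta_eq powr_add[symmetric] by (simp add: algebra_simps)
      then have "ennreal (M * ?Q powr (\<beta> j - (\<Sum>i\<in>?I. \<beta> i))) * ennreal (?Q powr (- \<beta> n)) =
        ennreal (M * ?Q powr (\<beta> j - (\<Sum>i=1..n. \<beta> i)))"
        using M by (simp add: ennreal_mult[symmetric] mult.assoc)
      then show ?thesis
        unfolding P M_def[symmetric] using s M n
        by (subst 0) (auto simp: ennreal_mult[symmetric] mult.assoc)
    qed simp
  qed
  finally show ?thesis .
qed

lemma nn_integral_inner_first_moment:
  assumes j: "j \<in> {1..<n}"
  shows "(\<integral>\<^sup>+q. ennreal (q j ^ Suc 0) * inner q \<partial>Pi\<^sub>M {1..<n} (\<lambda>_. lborel)) = ennreal (\<beta> j / (\<Sum>i=1..n. \<beta> i))"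
proof -
  define B where "B = (\<Sum>i=1..n. \<beta> i)"
  have B: "0 < B" using sum_beta_pos by (simp add: B_def)
  have bj: "0 < \<beta> j" using beta j by simp
  interpret fractional_gamma \<nu> "\<beta> j" using fg j by simp
  have "(\<integral>\<^sup>+q. ennreal (q j ^ Suc 0) * inner q \<partial>Pi\<^sub>M {1..<n} (\<lambda>_. lborel)) =
    (\<integral>\<^sup>+s. ennreal (\<beta> j) * ennreal (indicator {0<..} s * (\<nu> * s powr (\<nu> - 1) * (1 + s powr \<nu>) powr (-B - 1))) \<partial>lborel)"
    unfolding nn_integral_power_inner[OF j]
  proof (rule nn_integral_cong)
    fix s :: real
    show "ennreal (indicator {0<..} s * (s ^ 0 / fact 0 * (moment (Suc 0) s *
      (1 + s powr \<nu>) powr (\<beta> j - (\<Sum>i=1..n. \<beta> i))))) =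
      ennreal (\<beta> j) * ennreal (indicator {0<..} s * (\<nu> * s powr (\<nu> - 1) * (1 + s powr \<nu>) powr (-B - 1)))"
    proof (cases "0 < s")
      case True
      have "(1 + s powr \<nu>) powr (-\<beta> j - 1) * (1 + s powr \<nu>) powr (\<beta> j - B) = (1 + s powr \<nu>) powr (-B - 1)"
        unfolding powr_add[symmetric] by (rule arg_cong[where f = "\<lambda>x. _ powr x"]) simp
      then show ?thesis
        using True bj nu moment_1[OF True]
        by (simp add: ennreal_mult[symmetric] mult.assoc flip: B_def[unfolded One_nat_def])
    qed simp
  qed
  also have "\<dots> = ennreal (\<beta> j) * ennreal (1 / B)"
    using nn_integral_powr_one_plus_powr_1[OF nu(1) B] by (subst nn_integral_cmult) auto
  finally show ?thesis using bj B by (simp add: ennreal_mult[symmetric] B_def)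
qed

text \<open>The weight s of the kernel turns the two powers of \<open>s\<close> in
  \<open>moment_2\<close> into those of the Beta-type integrals. At \<nu> = 1 the second summand
  vanishes and the classical Dirichlet moment remains.\<close>

lemma nn_integral_inner_second_moment:
  assumes j: "j \<in> {1..<n}" and B_def: "B = (\<Sum>i=1..n. \<beta> i)"
  shows "(\<integral>\<^sup>+q. ennreal (q j ^ Suc 1) * inner q \<partial>Pi\<^sub>M {1..<n} (\<lambda>_. lborel)) =
    ennreal (\<beta> j * (\<beta> j + 1) * \<nu> / (B * (B + 1)) + \<beta> j * (1 - \<nu>) / B)"
proof -
  have B: "0 < B" using sum_beta_pos by (simp add: B_def)
  have bj: "0 < \<beta> j" using beta j by simp
  interpret fractional_gamma \<nu> "\<beta> j" using fg j by simp
  have "(\<integral>\<^sup>+q. ennreal (q j ^ Suc 1) * inner q \<partial>Pi\<^sub>M {1..<n} (\<lambda>_. lborel)) =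
    (\<integral>\<^sup>+s. ennreal (\<beta> j * (\<beta> j + 1) * \<nu>) * ennreal (indicator {0<..} s * (\<nu> * s powr (2 * \<nu> - 1) * (1 + s powr \<nu>) powr (-B - 2))) +
      ennreal (\<beta> j * (1 - \<nu>)) * ennreal (indicator {0<..} s * (\<nu> * s powr (\<nu> - 1) * (1 + s powr \<nu>) powr (-B - 1))) \<partial>lborel)"
    unfolding nn_integral_power_inner[OF j]
  proof (rule nn_integral_cong)
    fix s :: real
    show "ennreal (indicator {0<..} s * (s ^ 1 / fact 1 * (moment (Suc 1) s *
      (1 + s powr \<nu>) powr (\<beta> j - (\<Sum>i=1..n. \<beta> i))))) =
      ennreal (\<beta> j * (\<beta> j + 1) * \<nu>) * ennreal (indicator {0<..} s * (\<nu> * s powr (2 * \<nu> - 1) * (1 + s powr \<nu>) powr (-B - 2))) +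
      ennreal (\<beta> j * (1 - \<nu>)) * ennreal (indicator {0<..} s * (\<nu> * s powr (\<nu> - 1) * (1 + s powr \<nu>) powr (-B - 1)))"
    proof (cases "0 < s")
      case True
      let ?Q = "1 + s powr \<nu>"
      have Q: "?Q powr (-\<beta> j - 1) * ?Q powr (\<beta> j - B) = ?Q powr (-B - 1)"
        "?Q powr (-\<beta> j - 2) * ?Q powr (\<beta> j - B) = ?Q powr (-B - 2)"
        unfolding powr_add[symmetric] by (rule arg_cong[where f = "\<lambda>x. _ powr x"], simp)+
      have S: "s * s powr (2 * \<nu> - 2) = s powr (2 * \<nu> - 1)" "s * s powr (\<nu> - 2) = s powr (\<nu> - 1)"
        using True by (simp_all add: powr_mult_base)
      have "s * (moment 2 s * ?Q powr (\<beta> j - B)) =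
        \<beta> j * (\<beta> j + 1) * \<nu> * (\<nu> * (s * s powr (2 * \<nu> - 2)) * (?Q powr (-\<beta> j - 2) * ?Q powr (\<beta> j - B))) +
        \<beta> j * (1 - \<nu>) * (\<nu> * (s * s powr (\<nu> - 2)) * (?Q powr (-\<beta> j - 1) * ?Q powr (\<beta> j - B)))"
        unfolding moment_2[OF True] power2_eq_square distrib_left distrib_right by (simp only: mult_ac)
      then have "s * (moment 2 s * ?Q powr (\<beta> j - B)) =
        \<beta> j * (\<beta> j + 1) * \<nu> * (\<nu> * s powr (2 * \<nu> - 1) * ?Q powr (-B - 2)) +
        \<beta> j * (1 - \<nu>) * (\<nu> * s powr (\<nu> - 1) * ?Q powr (-B - 1))"
        unfolding Q S .
      then show ?thesis
        unfolding B_def[symmetric] using True bj nu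
        by (simp add: ennreal_mult[symmetric] ennreal_plus[symmetric] numeral_2_eq_2[symmetric] del: ennreal_plus)
    qed simp
  qed
  also have "\<dots> = ennreal (\<beta> j * (\<beta> j + 1) * \<nu>) * ennreal (1 / (B * (B + 1))) + ennreal (\<beta> j * (1 - \<nu>)) * ennreal (1 / B)"
    using nn_integral_powr_one_plus_powr_1[OF nu(1) B] nn_integral_powr_one_plus_powr_2[OF nu(1) B]
    by (subst nn_integral_add) (auto simp: nn_integral_cmult)
  also have "\<dots> = ennreal (\<beta> j * (\<beta> j + 1) * \<nu> / (B * (B + 1)) + \<beta> j * (1 - \<nu>) / B)"
    using bj B nu by (simp add: ennreal_mult[symmetric] ennreal_plus[symmetric] del: ennreal_plus)
  finally show ?thesis .
qed

text \<open>
  The Bochner integral in the density is \<open>0\<close> wherever it diverges, so the finiteness of the first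
  moment is needed to identify the density with the nonnegative integral \<open>inner\<close>.
\<close>

lemma AE_density_eq_inner:
  "AE q in Pi\<^sub>M {1..<n} (\<lambda>_. lborel). ennreal (fractional_dirichlet_density \<nu> n \<beta> q) = inner q"
proof -
  \<comment> \<open>Some coordinate must exist, which n \<ge> 2 guarantees; it is positive on the
    simplex, so finiteness of q_1 times \<open>inner\<close> passes to \<open>inner\<close>.\<close>
  have 1: "1 \<in> {1..<n}" using n by simp
  note [measurable] = component_measurable[OF 1]
  have "(\<integral>\<^sup>+q. ennreal (q 1 ^ Suc 0) * inner q \<partial>Pi\<^sub>M {1..<n} (\<lambda>_. lborel)) \<noteq> \<infinity>"
    unfolding nn_integral_inner_first_moment[OF 1] by simp
  then have "AE q in Pi\<^sub>M {1..<n} (\<lambda>_. lborel). ennreal (q 1 ^ Suc 0) * inner q \<noteq> \<infinity>"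
    by (intro nn_integral_PInf_AE) measurable
  then show ?thesis
  proof eventually_elim
    case (elim q)
    show ?case
    proof (cases "(\<forall>i\<in>{1..<n}. 0 < q i) \<and> (\<Sum>i=1..<n. q i) < 1")
      case True
      then have "0 < q 1" using 1 by blast
      then have "inner q \<noteq> \<infinity>" using elim by (auto simp: ennreal_mult_eq_top_iff)
      then show ?thesis using True density_inside_simplex(2) by blast
    qed (simp add: density_outside_simplex)
  qed
qed

text \<open>An almost everywhere equality of densities is enough to transfer the moment of
  \<open>inner\<close> to the law of \<open>Q\<close>; finiteness of that value yields integrability
  at the same time.\<close>

lemma expectation_power:
  assumes D: "distributed M (\<Pi>\<^sub>M i\<in>{1..<n}. lborel) (\<lambda>\<omega>. \<lambda>i\<in>{1..<n}. Q i \<omega>)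
      (\<lambda>q. ennreal (fractional_dirichlet_density \<nu> n \<beta> q))"
    and j: "j \<in> {1..<n}" and c: "0 \<le> c"
    and inner: "(\<integral>\<^sup>+q. ennreal (q j ^ k) * inner q \<partial>Pi\<^sub>M {1..<n} (\<lambda>_. lborel)) = ennreal c"
  shows "has_bochner_integral M (\<lambda>\<omega>. Q j \<omega> ^ k) c"
proof -
  let ?f = "fractional_dirichlet_density \<nu> n \<beta>"
  note [measurable] = component_measurable[OF j]
  have [measurable]: "?f \<in> borel_measurable (Pi\<^sub>M {1..<n} (\<lambda>_. lborel))"
    using distributed_real_measurable[OF density_nonneg D] .
  have pos: "0 \<le> ?f q * q j ^ k" for q
  proof (cases "(\<forall>i\<in>{1..<n}. 0 < q i) \<and> (\<Sum>i=1..<n. q i) < 1")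
    case True
    then have "0 < q j" using j by blast
    then show ?thesis using density_nonneg by simp
  qed (simp add: density_outside_simplex)
  have proj: "(\<lambda>q. q j ^ k :: real) \<in> borel_measurable (Pi\<^sub>M {1..<n} (\<lambda>_. lborel))"
    by (rule borel_measurable_power[OF component_measurable[OF j]])
  have meas: "(\<lambda>q. ?f q * q j ^ k) \<in> borel_measurable (Pi\<^sub>M {1..<n} (\<lambda>_. lborel))"
    using proj by (intro borel_measurable_times) measurable
  have "(\<integral>\<^sup>+q. ennreal (?f q * q j ^ k) \<partial>Pi\<^sub>M {1..<n} (\<lambda>_. lborel)) =
    (\<integral>\<^sup>+q. ennreal (q j ^ k) * inner q \<partial>Pi\<^sub>M {1..<n} (\<lambda>_. lborel))"
  proof (rule nn_integral_cong_AE, use AE_density_eq_inner in eventually_elim)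
    case (elim q)
    show ?case unfolding elim[symmetric] by (subst ennreal_mult'[OF density_nonneg]) (rule mult.commute)
  qed
  then have "has_bochner_integral (Pi\<^sub>M {1..<n} (\<lambda>_. lborel)) (\<lambda>q. ?f q * q j ^ k) c"
    unfolding inner using pos c meas by (intro has_bochner_integral_nn_integral) auto
  then show ?thesis
    using distributed_integral[OF D proj] distributed_integrable[OF D proj]
      density_nonneg j
    by (simp add: has_bochner_integral_iff)
qed

end

theorem proposition2p1:
  fixes M :: "'a measure" and Q :: "nat \<Rightarrow> 'a \<Rightarrow> real"
    and n :: nat and \<nu> :: real and \<beta> :: "nat \<Rightarrow> real" and \<beta>bar :: real
  assumes "prob_space M"
    and "n \<ge> 2"
    and "0 < \<nu>" and "\<nu> \<le> 1"
    and "\<And>i. i \<in> {1..n} \<Longrightarrow> 0 < \<beta> i"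
    and "\<beta>bar = (\<Sum>i=1..n. \<beta> i)"
    and "distributed M (\<Pi>\<^sub>M i\<in>{1..<n}. lborel) (\<lambda>\<omega>. \<lambda>i\<in>{1..<n}. Q i \<omega>)
           (\<lambda>q. ennreal (fractional_dirichlet_density \<nu> n \<beta> q))"
  shows "\<forall>j\<in>{1..<n}.
           prob_space.expectation M (Q j) = \<beta> j / \<beta>bar \<and>
           prob_space.variance M (Q j) =
             \<beta> j * (\<beta>bar - \<beta> j) / (\<beta>bar\<^sup>2 * (\<beta>bar + 1)) * (1 + \<beta>bar * (1 - \<nu>))"
proof
  fix j assume j: "j \<in> {1..<n}"
  interpret prob_space M by fact
  interpret fractional_dirichlet \<nu> n \<beta> using assms by unfold_locales auto
  have B: "0 < \<beta>bar" using sum_beta_pos assms(6) by simp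
  have bj: "0 < \<beta> j" using beta j by simp
  have 1: "has_bochner_integral M (\<lambda>\<omega>. Q j \<omega> ^ Suc 0) (\<beta> j / \<beta>bar)"
    using expectation_power[OF assms(7) j _ nn_integral_inner_first_moment[OF j]] B bj
    by (simp add: assms(6))
  have 2: "has_bochner_integral M (\<lambda>\<omega>. Q j \<omega> ^ Suc 1)
    (\<beta> j * (\<beta> j + 1) * \<nu> / (\<beta>bar * (\<beta>bar + 1)) + \<beta> j * (1 - \<nu>) / \<beta>bar)"
    using expectation_power[OF assms(7) j _ nn_integral_inner_second_moment[OF j assms(6)]] B bj nu by simp
  have E: "expectation (Q j) = \<beta> j / \<beta>bar" using 1 by (simp add: has_bochner_integral_iff)
  have "variance (Q j) = \<beta> j * (\<beta> j + 1) * \<nu> / (\<beta>bar * (\<beta>bar + 1)) + \<beta> j * (1 - \<nu>) / \<beta>bar - (\<beta> j / \<beta>bar)\<^sup>2"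
    using 1 2 by (subst variance_eq) (simp_all add: has_bochner_integral_iff power2_eq_square)
  \<comment> \<open>Over the denominator B^2 (B + 1), with b = \<beta>_j, the numerator divided by b
    is (b + 1)\<nu>B + (1 - \<nu>)B(B + 1) - b(B + 1), which equals (B - b)(1 + B(1 -
    \<nu>)).\<close>
  also have "\<dots> = \<beta> j * (\<beta>bar - \<beta> j) / (\<beta>bar\<^sup>2 * (\<beta>bar + 1)) * (1 + \<beta>bar * (1 - \<nu>))"
  proof -
    have "\<beta>bar + 1 \<noteq> 0" "\<beta>bar \<noteq> 0" using B by auto
    then show ?thesis by (simp add: divide_simps power2_eq_square) (simp add: algebra_simps)
  qed
  finally show "expectation (Q j) = \<beta> j / \<beta>bar \<and>
    variance (Q j) = \<beta> j * (\<beta>bar - \<beta> j) / (\<beta>bar\<^sup>2 * (\<beta>bar + 1)) * (1 + \<beta>bar * (1 - \<nu>))"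
    using E by simp
qed

end
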